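(* Let $G$ be a graph with maximum degree $\Delta\ge 6$ and clique number $\omega=\Delta-1$, such that the $\omega$-cliques of $G$ are pairwise vertex-disjoint and no vertex outside an $\omega$-clique $C$ has more than one neighbour in $C$. Then for any rational $0\le y\le\tilde y(\Delta)$ there is a vertex weighting $w:V(G)\to[0,\infty)$ and a fractional $y\wr w$-colouring of $G$ such that $\rho_{\mathbf 1-w}(G)\le \Delta-(1+\mu(\Delta))y$.
   Context: All numbers are rational. A fractional $y\wr w$-colouring is an assignment of nonnegative weights to stable sets of $G$ with total weight $y$ such that each vertex $v$ lies in stable sets of total weight at least $w(v)$. $\mathbf 1$ is the weighting constantly equal to $1$. For a weighting $u$ and vertex $v$, with $\tilde N(v)$ the closed neighbourhood: $u_d(v)=\sum_{x\in\tilde N(v)}u(x)$, $u_c(v)=\max$ over cliques $C\ni v$ of $\sum_{x\in C}u(x)$, $\rho_u(v)=\tfrac12(u_d(v)+u_c(v))$, $\rho_u(G)=\max_v\rho_u(v)$. With $\omega=\Delta-1$, $p(\Delta,d) = \frac{\sum_{i=0}^{3}\tfrac14 \Pr(\mathrm{Bin}(d,4/\omega) \le i)}{(\Delta-d)+1}$ for $0\le d\le\Delta$; $\mu_k(\Delta)=\min_{0\le d\le k}p(\Delta,d)$, $\mu(\Delta)=\mu_\Delta(\Delta)$. For $1\le k\le3$, $\tilde y_k(\Delta)$ is the maximum $y$ with $(1+\mu(\Delta))y\le\tfrac12(\Delta-1-k)+(\tfrac12+\tfrac12k\mu(\Delta))y$; for $4\le k\le\Delta-2$, $\tilde y_k(\Delta)$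 is the maximum $y$ with $(1+\mu(\Delta))y\le\tfrac12(\Delta-1-k)+(\tfrac12+\tfrac12k\mu_{\Delta+1-k}(\Delta))y$. Then $\tilde y(\Delta)=\min\{\min_{1\le k\le\Delta-2}\tilde y_k(\Delta),\ \omega,\ \frac{\omega-3}{1-3\mu(\Delta)}\}$. *)

theory Defs
  imports "HOL-Probability.Probability" "HOL-Library.Ramsey"
begin

section \<open>Graphs\<close>

text \<open>
  A finite simple graph is given by a vertex set \<open>V\<close> and a set \<open>E\<close> of two-element subsets of \<open>V\<close>.
  Since \<^const>\<open>clique\<close> and \<^const>\<open>indep\<close> do not relate their first argument to a vertex set, the
  cliques and stable sets of the graph are cut down to subsets of \<open>V\<close>.
\<close>

definition fin_graph :: "'a set \<Rightarrow> 'a set set \<Rightarrow> bool" where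
  "fin_graph V E \<longleftrightarrow> finite V \<and> E \<subseteq> [V]\<^bsup>2\<^esup>"

definition nbhd :: "'a set \<Rightarrow> 'a set set \<Rightarrow> 'a \<Rightarrow> 'a set" where
  "nbhd V E v = {x \<in> V. {v, x} \<in> E}"

definition closed_nbhd :: "'a set \<Rightarrow> 'a set set \<Rightarrow> 'a \<Rightarrow> 'a set" where
  "closed_nbhd V E v = insert v (nbhd V E v)"

definition max_degree :: "'a set \<Rightarrow> 'a set set \<Rightarrow> nat" where
  "max_degree V E = Max ((\<lambda>v. card (nbhd V E v)) ` V)"

definition cliques :: "'a set \<Rightarrow> 'a set set \<Rightarrow> 'a set set" where
  "cliques V E = {C. C \<subseteq> V \<and> clique C E}"

definition stable_sets :: "'a set \<Rightarrow> 'a set set \<Rightarrow> 'a set set" where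
  "stable_sets V E = {S. S \<subseteq> V \<and> indep S E}"

definition clique_number :: "'a set \<Rightarrow> 'a set set \<Rightarrow> nat" where
  "clique_number V E = Max (card ` cliques V E)"

definition omega_cliques :: "'a set \<Rightarrow> 'a set set \<Rightarrow> 'a set set" where
  "omega_cliques V E = {C \<in> cliques V E. card C = clique_number V E}"

section \<open>Weightings and fractional colourings\<close>

definition frac_colouring ::
    "'a set \<Rightarrow> 'a set set \<Rightarrow> rat \<Rightarrow> ('a \<Rightarrow> rat) \<Rightarrow> ('a set \<Rightarrow> rat) \<Rightarrow> bool" where
  "frac_colouring V E y w f \<longleftrightarrow>
     (\<forall>S \<in> stable_sets V E. 0 \<le> f S) \<and>
     (\<Sum>S \<in> stable_sets V E. f S) = y \<and>
     (\<forall>v \<in> V. w v \<le> (\<Sum>S \<in> {S \<in> stable_sets V E. v \<in> S}. f S))"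

definition wdeg :: "'a set \<Rightarrow> 'a set set \<Rightarrow> ('a \<Rightarrow> rat) \<Rightarrow> 'a \<Rightarrow> rat" where
  "wdeg V E u v = (\<Sum>x \<in> closed_nbhd V E v. u x)"

definition wclique :: "'a set \<Rightarrow> 'a set set \<Rightarrow> ('a \<Rightarrow> rat) \<Rightarrow> 'a \<Rightarrow> rat" where
  "wclique V E u v = Max ((\<lambda>C. \<Sum>x \<in> C. u x) ` {C \<in> cliques V E. v \<in> C})"

definition rho_at :: "'a set \<Rightarrow> 'a set set \<Rightarrow> ('a \<Rightarrow> rat) \<Rightarrow> 'a \<Rightarrow> rat" where
  "rho_at V E u v = (wdeg V E u v + wclique V E u v) / 2"

definition rho :: "'a set \<Rightarrow> 'a set set \<Rightarrow> ('a \<Rightarrow> rat) \<Rightarrow> rat" where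
  "rho V E u = Max (rho_at V E u ` V)"

section \<open>The numerical bounds\<close>

text \<open>
  Throughout, \<open>\<omega> = \<Delta> - 1\<close> and \<open>\<Delta> \<ge> 6\<close>, so that \<open>4 / \<omega>\<close> is a probability. All values are rational;
  the type is \<^typ>\<open>real\<close> only because \<^const>\<open>binomial_pmf\<close> is real-valued.
\<close>

definition p_bound :: "nat \<Rightarrow> nat \<Rightarrow> real" where
  "p_bound \<Delta> d =
     (\<Sum>i = 0..3. 1 / 4 * measure_pmf.prob (binomial_pmf d (4 / (real \<Delta> - 1))) {..i})
       / ((real \<Delta> - real d) + 1)"

definition mu_upto :: "nat \<Rightarrow> nat \<Rightarrow> real" where
  "mu_upto k \<Delta> = Min (p_bound \<Delta> ` {0..k})"

definition mu :: "nat \<Rightarrow> real" where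
  "mu \<Delta> = mu_upto \<Delta> \<Delta>"

text \<open>
  For \<open>1 \<le> k \<le> \<Delta> - 2\<close> the maximum below exists: \<open>p_bound \<Delta> 0 = 1 / (\<Delta> + 1)\<close> bounds every
  \<open>mu_upto j \<Delta>\<close>, so \<open>y\<close> has a larger coefficient on the left than on the right.
\<close>

definition ytilde_k :: "nat \<Rightarrow> nat \<Rightarrow> real" where
  "ytilde_k k \<Delta> =
     (if k \<le> 3
      then (GREATEST y. (1 + mu \<Delta>) * y
              \<le> 1 / 2 * (real \<Delta> - 1 - real k) + (1 / 2 + 1 / 2 * real k * mu \<Delta>) * y)
      else (GREATEST y. (1 + mu \<Delta>) * y
              \<le> 1 / 2 * (real \<Delta> - 1 - real k)
                 + (1 / 2 + 1 / 2 * real k * mu_upto (\<Delta> + 1 - k) \<Delta>) * y))"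

definition ytilde :: "nat \<Rightarrow> real" where
  "ytilde \<Delta> =
     Min {Min ((\<lambda>k. ytilde_k k \<Delta>) ` {1..\<Delta> - 2}),
          real \<Delta> - 1,
          ((real \<Delta> - 1) - 3) / (1 - 3 * mu \<Delta>)}"

end

theory Submission
  imports Defs
begin

text \<open>
  Every vertex of an \<open>\<omega>\<close>-clique has at most two neighbours outside it. Choose four vertices of every
  \<open>\<omega>\<close>-clique at random; by the fractional version of Haxell's theorem (due to Aharoni, Berger and Ziv),
  the chosen sets have a random independent transversal \<open>T\<close> containing each chosen vertex with
  probability \<open>1/4\<close>. A vertex \<open>v\<close> outside the \<open>\<omega>\<close>-cliques with \<open>d\<close> neighbours in them sees
  \<open>Bin(d, 4/\<omega>)\<close> chosen vertices, so \<open>T\<close> avoids its neighbourhood with probability at least the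
  numerator of \<open>p(\<Delta>, d)\<close>. Independently, a fractional Caro--Wei bound gives a random stable set \<open>B\<close>
  outside the \<open>\<omega>\<close>-cliques containing \<open>v\<close> with probability at least \<open>1/(\<Delta> - d + 1)\<close>. A maximal stable set
  containing \<open>T\<close> and the part of \<open>B\<close> not adjacent to \<open>T\<close> then contains \<open>v\<close> with probability at least
  \<open>p(\<Delta>, d)\<close>, meets every closed neighbourhood, and meets every \<open>\<omega>\<close>-clique exactly once.
\<close>

section \<open>Linear programming duality over the rationals\<close>

text \<open>The four is twice the bound on the neighbours that a vertex has in other
  \<open>\<omega>\<close>-cliques: Haxell's theorem needs parts of twice the maximum degree. If each
  vertex of the cliques is hit with probability \<open>1/\<omega>\<close>, a plain union bound gives
  only \<open>1 - d/\<omega>\<close>, which is void for \<open>d >= \<omega>\<close>. With four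
  vertices per clique chosen beforehand, the number N of chosen neighbours is random and the union
  bound can be cut off at 0 for each choice. The numerator of p is the mean of
  \<open>max(0, 1 - N/4)\<close>, which is always positive. The colouring gives the random stable
  set total weight y, so \<open>w(v)\<close> is y times the probability of v. On an
  \<open>\<omega>\<close>-clique these probabilities must be known exactly: their sum 1 lowers both
  halves of \<open>\<rho>\<close> by y. Every distribution comes from duality: for each weighting
  one sufficiently heavy set is found. As colourings are rational, duality is proved over the
  rationals; and the test weights are made integral so that lowering them in the weighted Haxell
  argument terminates.\<close>

definition mixtures :: "('j \<Rightarrow> rat) set \<Rightarrow> ('j \<Rightarrow> rat) set" where
  "mixtures A = {v. \<exists>l. (\<forall>a\<in>A. 0 \<le> l a) \<and> (\<Sum>a\<in>A. l a) = 1 \<and> v = (\<lambda>j. \<Sum>a\<in>A. l a * a j)}"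

lemma mixtures_superset:
  assumes "finite A" "a \<in> A"
  shows "a \<in> mixtures A"
  unfolding mixtures_def mem_Collect_eq using assms
  by (intro exI[of _ "\<lambda>b. if b = a then 1 else 0"])
     (auto simp: if_distrib[of "\<lambda>t. t * _"] cong: if_cong)

lemma mixtures_convex:
  assumes "u \<in> mixtures A" "v \<in> mixtures A" "0 \<le> s" "0 \<le> t" "s + t = 1"
  shows "(\<lambda>j. s * u j + t * v j) \<in> mixtures A"
proof -
  obtain l where l: "\<forall>a\<in>A. 0 \<le> l a" "(\<Sum>a\<in>A. l a) = 1" "u = (\<lambda>j. \<Sum>a\<in>A. l a * a j)"
    using assms(1) by (auto simp: mixtures_def)
  obtain m where m: "\<forall>a\<in>A. 0 \<le> m a" "(\<Sum>a\<in>A. m a) = 1" "v = (\<lambda>j. \<Sum>a\<in>A. m a * a j)"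
    using assms(2) by (auto simp: mixtures_def)
  show ?thesis
    unfolding mixtures_def mem_Collect_eq
  proof (intro exI[of _ "\<lambda>a. s * l a + t * m a"] conjI)
    show "\<forall>a\<in>A. 0 \<le> s * l a + t * m a" using assms l m by simp
    show "(\<Sum>a\<in>A. s * l a + t * m a) = 1"
      by (simp add: sum.distrib l(2) m(2) assms(5) flip: sum_distrib_left)
    show "(\<lambda>j. s * u j + t * v j) = (\<lambda>j. \<Sum>a\<in>A. (s * l a + t * m a) * a j)"
      by (simp add: l(3) m(3) sum_distrib_left distrib_right sum.distrib mult.assoc)
  qed
qed

text \<open>Each elimination step replaces \<open>A\<close> by a finite set of convex combinations
  of its members; this carries the mixture found there back to \<open>A\<close>.\<close>

lemma mixtures_idem:
  assumes "finite B" "B \<subseteq> mixtures A"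
  shows "mixtures B \<subseteq> mixtures A"
proof
  fix v assume "v \<in> mixtures B"
  then obtain m where m: "\<forall>b\<in>B. 0 \<le> m b" "(\<Sum>b\<in>B. m b) = 1" "v = (\<lambda>j. \<Sum>b\<in>B. m b * b j)"
    by (auto simp: mixtures_def)
  have "\<forall>b\<in>B. \<exists>l. (\<forall>a\<in>A. 0 \<le> l a) \<and> (\<Sum>a\<in>A. l a) = 1 \<and> (\<forall>j. b j = (\<Sum>a\<in>A. l a * a j))"
  proof
    fix b assume "b \<in> B"
    then obtain l where "\<forall>a\<in>A. 0 \<le> l a" "(\<Sum>a\<in>A. l a) = 1" "b = (\<lambda>j. \<Sum>a\<in>A. l a * a j)"
      using assms(2) unfolding mixtures_def by blast
    then show "\<exists>l. (\<forall>a\<in>A. 0 \<le> l a) \<and> (\<Sum>a\<in>A. l a) = 1 \<and> (\<forall>j. b j = (\<Sum>a\<in>A. l a * a j))"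
      by (intro exI[of _ l]) simp
  qed
  from bchoice[OF this] obtain l where "\<forall>b\<in>B. (\<forall>a\<in>A. 0 \<le> l b a) \<and> (\<Sum>a\<in>A. l b a) = 1 \<and>
      (\<forall>j. b j = (\<Sum>a\<in>A. l b a * a j))" ..
  then have l: "\<And>b. b \<in> B \<Longrightarrow> \<forall>a\<in>A. 0 \<le> l b a" "\<And>b. b \<in> B \<Longrightarrow> (\<Sum>a\<in>A. l b a) = 1"
    and lb: "\<And>b j. b \<in> B \<Longrightarrow> b j = (\<Sum>a\<in>A. l b a * a j)"
    by simp_all
  show "v \<in> mixtures A"
    unfolding mixtures_def mem_Collect_eq
  proof (intro exI[of _ "\<lambda>a. \<Sum>b\<in>B. m b * l b a"] conjI)
    show "\<forall>a\<in>A. 0 \<le> (\<Sum>b\<in>B. m b * l b a)" using l m by (auto intro!: sum_nonneg)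
    have "(\<Sum>a\<in>A. \<Sum>b\<in>B. m b * l b a) = (\<Sum>b\<in>B. m b * (\<Sum>a\<in>A. l b a))"
      by (subst sum.swap) (simp add: sum_distrib_left)
    also have "\<dots> = 1" using l m by simp
    finally show "(\<Sum>a\<in>A. \<Sum>b\<in>B. m b * l b a) = 1" .
    have "v j = (\<Sum>a\<in>A. (\<Sum>b\<in>B. m b * l b a) * a j)" for j
    proof -
      have "v j = (\<Sum>b\<in>B. \<Sum>a\<in>A. m b * l b a * a j)"
        unfolding m(3) by (intro sum.cong refl) (simp add: lb sum_distrib_left mult.assoc)
      also have "\<dots> = (\<Sum>a\<in>A. (\<Sum>b\<in>B. m b * l b a) * a j)"
        by (subst sum.swap) (simp add: sum_distrib_right)
      finally show ?thesis .
    qed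
    then show "v = (\<lambda>j. \<Sum>a\<in>A. (\<Sum>b\<in>B. m b * l b a) * a j)" by blast
  qed
qed

text \<open>Provides the value of the eliminated variable, given its lower bounds \<open>P\<close>
  and upper bounds \<open>Q\<close>; either may be absent.\<close>

lemma exists_between_finite:
  fixes P Q :: "rat set"
  assumes "finite P" "finite Q" and "\<And>p q. p \<in> P \<Longrightarrow> q \<in> Q \<Longrightarrow> p < q"
  shows "\<exists>z. (\<forall>p\<in>P. p < z) \<and> (\<forall>q\<in>Q. z < q)"
proof (cases "P = {} \<or> Q = {}")
  case True
  then show ?thesis
  proof
    assume "P = {}"
    have "\<forall>q\<in>Q. Min (insert 0 Q) - 1 < q"
      using assms(2) by (metis Min_le diff_less_eq finite_insert insertCI less_add_one order_le_less_trans)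
    then show ?thesis using \<open>P = {}\<close> by blast
  next
    assume "Q = {}"
    have "\<forall>p\<in>P. p < Max (insert 0 P) + 1"
      using assms(1) by (metis Max_ge finite_insert insertCI less_add_one order_le_less_trans)
    then show ?thesis using \<open>Q = {}\<close> by blast
  qed
next
  case False
  then have "Max P < Min Q" using assms by simp
  then obtain z where "Max P < z" "z < Min Q" using dense by blast
  then show ?thesis using assms False by auto
qed

text \<open>Fourier--Motzkin elimination of one coordinate at a time.\<close>

lemma nonneg_mixture:
  assumes "finite J" "finite A"
    and "\<And>w. (\<And>j. 0 \<le> w j) \<Longrightarrow> \<exists>a\<in>A. 0 \<le> (\<Sum>j\<in>J. w j * a j)"
  shows "\<exists>v\<in>mixtures A. \<forall>j\<in>J. 0 \<le> v j"
  using assms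
proof (induction J arbitrary: A rule: finite_induct)
  case empty
  from empty.prems(2)[of "\<lambda>_. 0"] obtain a where "a \<in> A" by auto
  then show ?case using mixtures_superset[OF empty.prems(1)] by blast
next
  case (insert k J)
  \<comment> \<open>The convex combination of \<open>p\<close> and \<open>q\<close> whose coordinate
    \<open>k\<close> cancels; it is used for \<open>p k > 0 > q k\<close> only, where both
    coefficients are positive.\<close>
  define cmb where "cmb p q = (\<lambda>j. (- q k) / (p k - q k) * p j + p k / (p k - q k) * q j)"
    for p q :: "'a \<Rightarrow> rat"
  define P where "P = {a\<in>A. 0 < a k}"
  define N where "N = {a\<in>A. a k < 0}"
  define B where "B = {a\<in>A. 0 \<le> a k} \<union> (\<lambda>(p,q). cmb p q) ` (P \<times> N)"
  have fin: "finite P" "finite N" "finite B" using insert.prems by (auto simp: P_def N_def B_def)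
  have cmb_k: "cmb p q k = 0" if "p \<in> P" "q \<in> N" for p q
    using that by (simp add: cmb_def P_def N_def field_simps)
  have BA: "B \<subseteq> mixtures A"
  proof
    fix b assume "b \<in> B"
    then consider "b \<in> A" | p q where "p \<in> P" "q \<in> N" "b = cmb p q" by (auto simp: B_def)
    then show "b \<in> mixtures A"
    proof cases
      case 1 then show ?thesis using mixtures_superset insert.prems(1) by blast
    next
      case 2
      then have pq: "p \<in> A" "q \<in> A" "0 < p k" "q k < 0" by (auto simp: P_def N_def)
      show ?thesis unfolding 2(3) cmb_def
        using pq insert.prems(1)
        by (intro mixtures_convex mixtures_superset) (auto simp: divide_simps)
    qed
  qed
  have Bk: "0 \<le> b k" if "b \<in> B" for b
    using that cmb_k by (auto simp: B_def)
  have "\<exists>b\<in>B. 0 \<le> (\<Sum>j\<in>J. w j * b j)" if w: "\<And>j. 0 \<le> w j" for w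
  proof (rule ccontr)
    assume neg: "\<not> ?thesis"
    define s where "s a = (\<Sum>j\<in>J. w j * a j)" for a
    have neg': "s b < 0" if "b \<in> B" for b using neg that by (auto simp: s_def not_le)
    have pairs: "s q / (- q k) < - s p / p k" if "p \<in> P" "q \<in> N" for p q
    proof -
      have pq: "0 < p k" "q k < 0" using that by (auto simp: P_def N_def)
      have "s (cmb p q) < 0" using that by (intro neg') (auto simp: B_def)
      moreover have "s (cmb p q) = (- q k) / (p k - q k) * s p + p k / (p k - q k) * s q"
        by (simp add: s_def cmb_def sum_distrib_left sum.distrib distrib_left mult.left_commute
            sum_negf sum_subtractf right_diff_distrib)
      ultimately have "((- q k) * s p + p k * s q) / (p k - q k) < 0"
        by (simp add: diff_divide_distrib)
      then have "(- q k) * s p + p k * s q < 0" using pq by (simp add: divide_less_0_iff)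
      then show ?thesis using pq by (simp add: field_simps)
    qed
    have Ppos: "0 < - s p / p k" if "p \<in> P" for p
    proof -
      have "s p < 0" using that by (intro neg') (auto simp: B_def P_def)
      then show ?thesis using that by (simp add: P_def divide_neg_pos)
    qed
    \<comment> \<open>If \<open>w\<close> defeats all of \<open>B\<close>, a weight \<open>z\<close>
      for \<open>k\<close> is sought that defeats all of \<open>A\<close>. Rows with
      \<open>a k < 0\<close> bound \<open>z\<close> from below, rows with \<open>a k > 0\<close>
      from above, and the combinations in \<open>B\<close> say that these bounds are compatible. The
      inserted 0 keeps \<open>z\<close> admissible as a weight.\<close>
    have "\<exists>z. (\<forall>x\<in>insert 0 ((\<lambda>q. s q / (- q k)) ` N). x < z) \<and> (\<forall>x\<in>(\<lambda>p. - s p / p k) ` P. z < x)"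
    proof (rule exists_between_finite)
      fix x y assume x: "x \<in> insert 0 ((\<lambda>q. s q / (- q k)) ` N)" and "y \<in> (\<lambda>p. - s p / p k) ` P"
      then obtain p where p: "p \<in> P" "y = - s p / p k" by blast
      show "x < y"
      proof (cases "x = 0")
        case False
        then obtain q where "q \<in> N" "x = s q / (- q k)" using x by blast
        then show ?thesis using pairs p by blast
      qed (use p Ppos in simp)
    qed (use fin in auto)
    then obtain z where z: "\<forall>x\<in>insert 0 ((\<lambda>q. s q / (- q k)) ` N). x < z"
      "\<forall>x\<in>(\<lambda>p. - s p / p k) ` P. z < x" by blast
    have "s a + z * a k < 0" if aA: "a \<in> A" for a
    proof -
      consider "a k = 0" | "a \<in> P" | "a \<in> N"
        using aA linorder_less_linear[of "a k" 0] unfolding P_def N_def by blast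
      then show ?thesis
      proof cases
        case 1
        then show ?thesis using neg'[of a] aA by (simp add: B_def)
      next
        case 2
        then have "z < - s a / a k" "0 < a k" using z by (auto simp: P_def)
        then show ?thesis by (simp add: field_simps)
      next
        case 3
        then have "s a / (- a k) < z" "a k < 0" using z by (auto simp: N_def)
        then show ?thesis by (simp add: field_simps)
      qed
    qed
    moreover have "\<exists>a\<in>A. 0 \<le> (\<Sum>j\<in>insert k J. (w(k := z)) j * a j)"
      using w z by (intro insert.prems(2)) auto
    moreover have "(\<Sum>j\<in>insert k J. (w(k := z)) j * a j) = s a + z * a k" for a
    proof -
      have "(\<Sum>j\<in>J. (w(k := z)) j * a j) = s a"
        unfolding s_def using insert.hyps(2) by (intro sum.cong) auto
      then show ?thesis using insert.hyps by simp
    qed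
    ultimately show False by fastforce
  qed
  then have "\<exists>v\<in>mixtures B. \<forall>j\<in>J. 0 \<le> v j" by (rule insert.IH[OF fin(3)])
  then obtain v where v: "v \<in> mixtures B" "\<forall>j\<in>J. 0 \<le> v j" by blast
  moreover have "0 \<le> v k"
    using v(1) Bk by (auto simp: mixtures_def intro!: sum_nonneg)
  ultimately show ?case using mixtures_idem[OF fin(3) BA] by blast
qed

text \<open>The weighted Haxell theorem is an induction on an integer quantity, so rational test
  weights have to be scaled to integers.\<close>

lemma common_denominator:
  fixes w :: "'a \<Rightarrow> rat"
  assumes "finite J" and "\<And>j. 0 \<le> w j"
  obtains N :: int and u :: "'a \<Rightarrow> int"
  where "0 < N" "\<And>j. j \<in> J \<Longrightarrow> 0 \<le> u j" "\<And>j. j \<in> J \<Longrightarrow> of_int (u j) = of_int N * w j"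
proof -
  define den where "den j = snd (quotient_of (w j))" for j
  define num where "num j = fst (quotient_of (w j))" for j
  have den: "den j > 0" for j unfolding den_def by (simp add: quotient_of_denom_pos')
  have eq: "w j * of_int (den j) = of_int (num j)" for j
    using quotient_of_div[of "w j" "num j" "den j"] den[of j] unfolding den_def num_def by (simp add: nonzero_eq_divide_eq)
  define N where "N = prod den J"
  have N: "N > 0" unfolding N_def using den by (simp add: prod_pos)
  have u: "0 \<le> num j * prod den (J - {j}) \<and> of_int (num j * prod den (J - {j})) = of_int N * w j"
    if "j \<in> J" for j
  proof -
    have N': "N = den j * prod den (J - {j})" unfolding N_def using that assms(1) by (rule prod.remove[rotated])
    have e: "of_int (num j * prod den (J - {j})) = of_int N * w j"
      by (simp add: N' flip: eq)
    have "0 \<le> of_int N * w j" using N assms(2) by simp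
    then have "0 \<le> num j * prod den (J - {j})" unfolding e[symmetric] by (simp only: of_int_0_le_iff)
    then show ?thesis using e by blast
  qed
  show thesis by (rule that[of N "\<lambda>j. num j * prod den (J - {j})"]) (use N u in blast)+
qed

text \<open>The minimax principle, from \<open>nonneg_mixture\<close> for the vectors
  \<open>of_bool (v \<in> T) - t v\<close>. The condition on weights is homogeneous, so integer
  weights suffice as tests.\<close>

lemma fractional_cover:
  fixes t :: "'a \<Rightarrow> rat"
  assumes "finite F" "finite J"
    and heavy: "\<And>w :: 'a \<Rightarrow> int. (\<And>v. 0 \<le> w v) \<Longrightarrow>
      \<exists>T\<in>F. (\<Sum>v\<in>J. of_int (w v) * t v) \<le> (\<Sum>v\<in>J \<inter> T. of_int (w v))"
  shows "\<exists>l. (\<forall>T\<in>F. 0 \<le> l T) \<and> (\<Sum>T\<in>F. l T) = (1 :: rat) \<and>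
      (\<forall>v\<in>J. t v \<le> (\<Sum>T\<in>{T\<in>F. v \<in> T}. l T))"
proof -
  define row where "row T = (\<lambda>v. of_bool (v \<in> T) - t v)" for T
  \<comment> \<open>Rows are defined on all of the type and not only on \<open>J\<close>, so
    distinct sets have distinct rows and coefficients of rows become coefficients of sets.\<close>
  have inj: "inj_on row F"
  proof (rule inj_onI)
    fix S T assume "row S = row T"
    then have "row S v = row T v" for v by simp
    then have "v \<in> S \<longleftrightarrow> v \<in> T" for v unfolding row_def by (metis diff_add_cancel of_bool_eq_iff)
    then show "S = T" by blast
  qed
  have "\<exists>a\<in>row ` F. 0 \<le> (\<Sum>v\<in>J. w v * a v)" if w: "\<And>v. 0 \<le> w v" for w
  proof -
    obtain N :: int and u where N: "N > 0"
      and u: "\<And>j. j \<in> J \<Longrightarrow> 0 \<le> u j" "\<And>j. j \<in> J \<Longrightarrow> of_int (u j) = of_int N * w j"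
      using common_denominator[OF assms(2), of w] w by metis
    \<comment> \<open>\<open>heavy\<close> asks for nonnegative weights everywhere, while
      \<open>u\<close> is controlled only on \<open>J\<close>; hence the
      \<open>max 0\<close>.\<close>
    obtain T where T: "T \<in> F"
      and le: "(\<Sum>v\<in>J. of_int (max 0 (u v)) * t v) \<le> (\<Sum>v\<in>J \<inter> T. of_int (max 0 (u v)))"
      using heavy[of "\<lambda>v. max 0 (u v)"] by auto
    have "(\<Sum>v\<in>J. of_int (max 0 (u v)) * t v) = of_int N * (\<Sum>v\<in>J. w v * t v)"
      unfolding sum_distrib_left using u by (intro sum.cong) (auto simp: max_def)
    moreover have "(\<Sum>v\<in>J \<inter> T. of_int (max 0 (u v))) = of_int N * (\<Sum>v\<in>J. w v * of_bool (v \<in> T))"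
      unfolding sum_distrib_left using u assms(2)
      by (subst sum.inter_restrict) (auto simp: max_def intro!: sum.cong)
    ultimately have "of_int N * (\<Sum>v\<in>J. w v * t v) \<le> of_int N * (\<Sum>v\<in>J. w v * of_bool (v \<in> T))"
      using le by linarith
    then have "(\<Sum>v\<in>J. w v * t v) \<le> (\<Sum>v\<in>J. w v * of_bool (v \<in> T))"
      using N by simp
    then have "0 \<le> (\<Sum>v\<in>J. w v * row T v)"
      by (simp add: row_def right_diff_distrib sum_subtractf)
    then show ?thesis using T by blast
  qed
  from nonneg_mixture[OF assms(2) _ this] assms(1)
  obtain l where l: "\<forall>a\<in>row ` F. 0 \<le> l a" "(\<Sum>a\<in>row ` F. l a) = 1"
    "\<forall>v\<in>J. 0 \<le> (\<Sum>a\<in>row ` F. l a * a v)"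
    by (auto simp: mixtures_def)
  have s: "(\<Sum>T\<in>F. l (row T)) = 1" using l(2) by (simp add: sum.reindex[OF inj])
  have "t v \<le> (\<Sum>T\<in>{T\<in>F. v \<in> T}. l (row T))" if "v \<in> J" for v
  proof -
    have "0 \<le> (\<Sum>a\<in>row ` F. l a * a v)" using l(3) that by blast
    also have "\<dots> = (\<Sum>T\<in>F. l (row T) * row T v)" by (simp add: sum.reindex[OF inj])
    also have "\<dots> = (\<Sum>T\<in>F. l (row T) * (of_bool (v \<in> T) - t v))"
      by (intro sum.cong refl arg_cong2[of _ _ _ _ times]) (simp add: row_def)
    also have "\<dots> = (\<Sum>T\<in>F. l (row T) * of_bool (v \<in> T)) - t v"
      by (simp add: right_diff_distrib sum_subtractf s flip: sum_distrib_right)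
    also have "(\<Sum>T\<in>F. l (row T) * of_bool (v \<in> T)) = (\<Sum>T\<in>{T\<in>F. v \<in> T}. l (row T))"
      using assms(1) by (intro sum.mono_neutral_cong_right) auto
    finally show ?thesis by simp
  qed
  then show ?thesis using l(1) s by (intro exI[of _ "\<lambda>T. l (row T)"]) auto
qed

section \<open>Haxell's theorem\<close>

definition indep_transversal :: "('a \<Rightarrow> 'b) \<Rightarrow> ('a \<Rightarrow> 'a \<Rightarrow> bool) \<Rightarrow> 'a set \<Rightarrow> 'a set \<Rightarrow> bool" where
  "indep_transversal cls adj U M \<longleftrightarrow>
     M \<subseteq> U \<and> inj_on cls M \<and> cls ` M = cls ` U \<and> (\<forall>u\<in>M. \<forall>v\<in>M. \<not> adj u v)"

definition leaves :: "('a \<Rightarrow> 'a \<Rightarrow> bool) \<Rightarrow> 'a set \<Rightarrow> 'a list \<Rightarrow> 'a set" where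
  "leaves adj M xs = {v\<in>M. \<exists>x\<in>set xs. adj x v}"

text \<open>Haxell's construction, with the list of centres newest first. \<open>r\<close> is the
  part that \<open>M\<close> misses; the other admissible parts are those whose representative in
  \<open>M\<close> is already a leaf and is a candidate for an exchange. A new centre avoids the old
  leaves, so it starts a star with new leaves only.\<close>

fun star_forest :: "('a \<Rightarrow> 'b) \<Rightarrow> ('a \<Rightarrow> 'a \<Rightarrow> bool) \<Rightarrow> 'a set \<Rightarrow> 'b \<Rightarrow> 'a set \<Rightarrow> 'a list \<Rightarrow> bool" where
  "star_forest cls adj U r M [] = True"
| "star_forest cls adj U r M (x # xs) =
     (star_forest cls adj U r M xs \<and> x \<in> U \<and> cls x \<in> insert r (cls ` leaves adj M xs) \<and>
      (\<forall>d \<in> set xs \<union> leaves adj M xs. \<not> adj x d) \<and> (\<exists>v\<in>M. adj x v))"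

definition agrees :: "('a \<Rightarrow> 'a \<Rightarrow> bool) \<Rightarrow> 'a set \<Rightarrow> 'a set \<Rightarrow> 'a list \<Rightarrow> bool" where
  "agrees adj M M' xs \<longleftrightarrow> (\<forall>x\<in>set xs. {v\<in>M'. adj x v} = {v\<in>M. adj x v})"

text \<open>Lexicographic decrease of the stars, the head of the list being the newest centre.\<close>

fun improves :: "('a \<Rightarrow> 'a \<Rightarrow> bool) \<Rightarrow> 'a set \<Rightarrow> 'a set \<Rightarrow> 'a list \<Rightarrow> bool" where
  "improves adj M M' [] = False"
| "improves adj M M' (x # xs) =
     (improves adj M M' xs \<or> (agrees adj M M' xs \<and> {v\<in>M'. adj x v} \<subset> {v\<in>M. adj x v}))"

section \<open>Stars under a change of the transversal\<close>

lemma leaves_agrees: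
  assumes "agrees adj M M' xs"
  shows "leaves adj M' xs = leaves adj M xs"
  using assms unfolding leaves_def agrees_def by blast

lemma star_forest_agrees:
  assumes "agrees adj M M' xs" "star_forest cls adj U r M xs"
  shows "star_forest cls adj U r M' xs"
  using assms
proof (induction xs)
  case (Cons x xs)
  have a: "agrees adj M M' xs" "{v\<in>M'. adj x v} = {v\<in>M. adj x v}"
    using Cons.prems by (auto simp: agrees_def)
  have "\<exists>v\<in>M'. adj x v" using a(2) Cons.prems(2) by auto
  then show ?case using Cons a(1) by (simp add: leaves_agrees[OF a(1)])
qed simp

lemma improves_agrees:
  assumes "agrees adj M M' xs" "improves adj M' M'' xs"
  shows "improves adj M M'' xs"
  using assms
  by (induction xs) (auto simp: agrees_def)

text \<open>The oldest centre adjacent to \<open>y\<close> loses a leaf, and all centres older than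
  it keep their stars.\<close>

lemma improves_remove:
  assumes "\<forall>z\<in>set xs. {v\<in>M'. adj z v} = {v\<in>M. adj z v} - {y}" "y \<in> leaves adj M xs"
  shows "improves adj M M' xs"
  using assms
proof (induction xs)
  case (Cons z zs)
  show ?case
  proof (cases "y \<in> leaves adj M zs")
    case False
    then have "y \<in> M" "adj z y" "\<forall>x\<in>set zs. \<not> adj x y" using Cons.prems(2) by (auto simp: leaves_def)
    then have "agrees adj M M' zs" "{v\<in>M'. adj z v} \<subset> {v\<in>M. adj z v}"
      using Cons.prems(1) by (auto simp: agrees_def)
    then show ?thesis by simp
  qed (use Cons in auto)
qed (simp add: leaves_def)

text \<open>Every centre contributes a neighbour in \<open>M\<close> that cannot be an older leaf,
  because centres are not adjacent to older leaves.\<close>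

lemma star_forest_length_le:
  assumes "finite M" "star_forest cls adj U r M xs"
  shows "length xs \<le> card (leaves adj M xs)"
  using assms(2)
proof (induction xs)
  case (Cons x xs)
  then obtain v where v: "v \<in> M" "adj x v" "v \<notin> leaves adj M xs" by auto
  have "card (leaves adj M xs) < card (leaves adj M (x # xs))"
    using v assms(1) by (intro psubset_card_mono) (auto simp: leaves_def)
  then show ?case using Cons by simp
qed simp

text \<open>A leaf belongs to the star that created it, and no later centre is adjacent to
  it.\<close>

lemma star_forest_unique_centre:
  assumes "star_forest cls adj U r M xs" "y \<in> leaves adj M xs"
  shows "\<exists>c. {x\<in>set xs. adj x y} = {c}"
  using assms
proof (induction xs)
  case (Cons x xs)
  show ?case
  proof (cases "y \<in> leaves adj M xs")
    case True
    then have "\<not> adj x y" using Cons.prems by auto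
    then have "{z\<in>set (x # xs). adj z y} = {z\<in>set xs. adj z y}" by auto
    then show ?thesis using Cons True by simp
  next
    case False
    then have "{z\<in>set (x # xs). adj z y} = {x}" using Cons.prems by (auto simp: leaves_def)
    then show ?thesis by blast
  qed
qed (simp add: leaves_def)

text \<open>Edges inside a part are excluded, since they never matter for a set with one vertex per
  part. The degrees below thus count edges between parts only.\<close>

locale partitioned_graph =
  fixes cls :: "'a \<Rightarrow> 'b" and adj :: "'a \<Rightarrow> 'a \<Rightarrow> bool"
  assumes adj_sym: "adj u v \<Longrightarrow> adj v u"
    and adj_cls: "adj u v \<Longrightarrow> cls u \<noteq> cls v"
begin

lemma adj_commute: "adj u v \<longleftrightarrow> adj v u"
  using adj_sym by blast

lemma adj_irrefl: "\<not> adj u u"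
  using adj_cls by blast

text \<open>
  Among the transversals with the same stars so far, take one with the fewest neighbours of the new
  centre \<open>x\<close>. If there are none, \<open>x\<close> can replace the leaf in its part, which shrinks an older star.
\<close>

lemma haxell_step:
  assumes fin: "finite U" and r: "r \<in> R" and R: "R \<subseteq> cls ` U"
    and noIT: "\<not> (\<exists>M. indep_transversal cls adj {v\<in>U. cls v \<in> R} M)"
    and M: "indep_transversal cls adj {v\<in>U. cls v \<in> R - {r}} M"
    and xs: "star_forest cls adj U r M xs"
  shows "(\<exists>M xs. indep_transversal cls adj {v\<in>U. cls v \<in> R - {r}} M \<and> star_forest cls adj U r M xs \<and>
            (\<forall>v\<in>U. cls v \<in> insert r (cls ` leaves adj M xs) \<longrightarrow>
                  (\<exists>d \<in> set xs \<union> leaves adj M xs. adj v d)))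
       \<or> (\<exists>M'. indep_transversal cls adj {v\<in>U. cls v \<in> R - {r}} M' \<and> improves adj M M' xs)"
  using M xs
\<comment> \<open>Each recursive call adds a centre and therefore a new leaf, and there are at most
  \<open>card U\<close> leaves.\<close>
proof (induction "card U - card (leaves adj M xs)" arbitrary: M xs rule: less_induct)
  case less
  let ?IT = "indep_transversal cls adj {v\<in>U. cls v \<in> R - {r}}"
  show ?case (is "?success \<or> ?imp")
  proof (cases ?success)
    case False
    then have "\<not> (\<forall>v\<in>U. cls v \<in> insert r (cls ` leaves adj M xs) \<longrightarrow>
                  (\<exists>d \<in> set xs \<union> leaves adj M xs. adj v d))"
      using less.prems by blast
    then obtain x where x: "x \<in> U" "cls x \<in> insert r (cls ` leaves adj M xs)"
      "\<forall>d \<in> set xs \<union> leaves adj M xs. \<not> adj x d" by blast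
    define good where "good M' \<longleftrightarrow> ?IT M' \<and> agrees adj M M' xs" for M'
    have "good M" using less.prems by (simp add: good_def agrees_def)
    then obtain N where N: "good N" and Nmin: "\<And>M'. good M' \<Longrightarrow> card {v\<in>N. adj x v} \<le> card {v\<in>M'. adj x v}"
      using exists_least_iff[of "\<lambda>n. \<exists>M'. good M' \<and> card {v\<in>M'. adj x v} = n"]
      by (metis not_le)
    have ITN: "?IT N" and agr: "agrees adj M N xs" using N by (auto simp: good_def)
    have NU: "N \<subseteq> U" using ITN by (auto simp: indep_transversal_def)
    have finN: "finite N" using NU fin finite_subset by blast
    have Np: "cls ` N = R - {r}" using ITN R by (auto simp: indep_transversal_def)
    have lv: "leaves adj N xs = leaves adj M xs" by (rule leaves_agrees[OF agr])
    show ?thesis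
    proof (cases "\<exists>v\<in>N. adj x v")
      case False
      have x_free: "\<not> adj x v \<and> \<not> adj v x" if "v \<in> N" for v using False that adj_commute by blast
      show ?thesis
      proof (cases "cls x = r")
        case True
        \<comment> \<open>\<open>N\<close> represents every part of \<open>R\<close> except
          \<open>r\<close>, so an \<open>x\<close> in part \<open>r\<close> without neighbours in
          \<open>N\<close> completes it, against \<open>noIT\<close>.\<close>
        have "indep_transversal cls adj {v\<in>U. cls v \<in> R} (insert x N)"
          unfolding indep_transversal_def
        proof (intro conjI)
          show "insert x N \<subseteq> {v \<in> U. cls v \<in> R}"
            using ITN x(1) True r by (auto simp: indep_transversal_def)
          show "inj_on cls (insert x N)"
            using ITN True Np by (auto simp: indep_transversal_def)
          have "cls ` {v \<in> U. cls v \<in> R} = R" using R by blast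
          then show "cls ` insert x N = cls ` {v \<in> U. cls v \<in> R}" using True Np r by auto
          show "\<forall>u\<in>insert x N. \<forall>v\<in>insert x N. \<not> adj u v"
            using ITN x_free adj_irrefl unfolding indep_transversal_def by auto
        qed
        then show ?thesis using noIT by blast
      next
        case neq: False
        then obtain y where y: "y \<in> leaves adj N xs" "cls x = cls y" using x(2) lv by auto
        have yN: "y \<in> N" using y(1) by (simp add: leaves_def)
        define N' where "N' = insert x (N - {y})"
        have inj: "inj_on cls N'"
        proof -
          have "cls x \<notin> cls ` (N - {y})"
            using ITN yN y(2) unfolding indep_transversal_def inj_on_def by auto
          moreover have "inj_on cls (N - {y})"
            using ITN unfolding indep_transversal_def by (meson Diff_subset inj_on_subset)
          ultimately show ?thesis unfolding N'_def inj_on_insert by blast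
        qed
        have "cls ` N' = cls ` N" unfolding N'_def using y(2) yN by auto
        moreover have "N' \<subseteq> {v\<in>U. cls v \<in> R - {r}}"
          using ITN x(1) y(2) yN Np unfolding N'_def indep_transversal_def by auto
        moreover have "\<forall>u\<in>N'. \<forall>v\<in>N'. \<not> adj u v"
          using ITN x_free adj_irrefl unfolding N'_def indep_transversal_def by auto
        ultimately have IT': "?IT N'" using inj ITN by (simp add: indep_transversal_def)
        \<comment> \<open>\<open>x\<close> is adjacent to no centre, so exchanging \<open>y\<close>
          for \<open>x\<close> removes \<open>y\<close> from the stars and adds nothing.\<close>
        have "improves adj N N' xs"
        proof (rule improves_remove[OF _ y(1)])
          show "\<forall>z\<in>set xs. {v\<in>N'. adj z v} = {v\<in>N. adj z v} - {y}"
            using x(3) adj_commute[of x] unfolding N'_def by auto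
        qed
        then show ?thesis using improves_agrees[OF agr] IT' by blast
      qed
    next
      case True
      have sf: "star_forest cls adj U r N (x # xs)"
        using star_forest_agrees[OF agr less.prems(2)] x True by (simp add: lv)
      obtain v where "v \<in> N" "adj x v" using True by blast
      then have "v \<in> leaves adj N (x # xs)" "v \<notin> leaves adj N xs"
        using x(3) lv by (auto simp: leaves_def)
      then have "leaves adj N xs \<subset> leaves adj N (x # xs)" by (auto simp: leaves_def)
      then have "card (leaves adj M xs) < card (leaves adj N (x # xs))"
        using finN unfolding lv[symmetric] by (intro psubset_card_mono) (auto simp: leaves_def)
      moreover have "card (leaves adj N (x # xs)) \<le> card U"
        using NU fin by (intro card_mono) (auto simp: leaves_def)
      ultimately have "card U - card (leaves adj N (x # xs)) < card U - card (leaves adj M xs)" by simp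
      from less.hyps[OF this ITN sf] False
      obtain M' where M': "?IT M'" "improves adj N M' (x # xs)" by blast
      then consider "improves adj N M' xs" | "agrees adj N M' xs" "{v\<in>M'. adj x v} \<subset> {v\<in>N. adj x v}"
        by auto
      then show ?thesis
      proof cases
        case 1 then show ?thesis using improves_agrees[OF agr] M'(1) by blast
      next
        \<comment> \<open>The older stars are unchanged and that of \<open>x\<close> has shrunk,
          against the choice of \<open>N\<close>.\<close>
        case 2
        then have "good M'" using M'(1) agr by (simp add: good_def agrees_def)
        moreover have "card {v\<in>M'. adj x v} < card {v\<in>N. adj x v}"
          using 2(2) finN by (intro psubset_card_mono) auto
        ultimately show ?thesis using Nmin by fastforce
      qed
    qed
  qed blast
qed

text \<open>\<open>L\<close> and \<open>X\<close> are the leaves and centres of a forest that cannot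
  be extended. \<open>I\<close> consists of the root part and the parts of the leaves, which
  accounts for the strict inequality between \<open>card L\<close> and \<open>card I\<close>.
  Besides the usual domination of the parts in \<open>I\<close> by at most \<open>2 * card L\<close>
  vertices, the conclusion records that each leaf sees exactly one centre and no leaf; the weighted
  version depends on this.\<close>

theorem haxell_dichotomy:
  assumes fin: "finite U" and noIT: "\<not> (\<exists>M. indep_transversal cls adj U M)"
  obtains L X I where "L \<subseteq> U" "X \<subseteq> U" "inj_on cls L" "I \<subseteq> cls ` U" "cls ` L \<subseteq> I" "card L < card I" "card X \<le> card L"
    "\<And>u v. u \<in> L \<Longrightarrow> v \<in> L \<Longrightarrow> \<not> adj u v"
    "\<And>y. y \<in> L \<Longrightarrow> \<exists>c. {x\<in>X. adj y x} = {c}"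
    "\<And>v. v \<in> U \<Longrightarrow> cls v \<in> I \<Longrightarrow> \<exists>d \<in> X \<union> L. adj v d"
proof -
  define bad where "bad R \<longleftrightarrow> R \<subseteq> cls ` U \<and> \<not> (\<exists>M. indep_transversal cls adj {v\<in>U. cls v \<in> R} M)" for R
  have "{v\<in>U. cls v \<in> cls ` U} = U" by auto
  then have "bad (cls ` U)" using noIT by (simp add: bad_def)
  \<comment> \<open>By minimality of this family of parts, omitting any part \<open>r\<close> leaves
    a family with an independent transversal to start from.\<close>
  then obtain R where R: "bad R" and Rmin: "\<And>R'. bad R' \<Longrightarrow> card R \<le> card R'"
    using exists_least_iff[of "\<lambda>n. \<exists>R. bad R \<and> card R = n"] by (metis not_le)
  have finR: "finite R" using R fin by (auto simp: bad_def intro: finite_subset)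
  have "\<not> bad {}" by (auto simp: bad_def indep_transversal_def)
  then obtain r where r: "r \<in> R" using R by fastforce
  have "card (R - {r}) < card R" using r finR by (meson card_Diff1_less)
  then have "\<not> bad (R - {r})" using Rmin by fastforce
  then obtain M0 where M0: "indep_transversal cls adj {v\<in>U. cls v \<in> R - {r}} M0"
    using R by (auto simp: bad_def)
  \<comment> \<open>An empty forest cannot be improved, so the first alternative of
    \<open>haxell_step\<close> remains.\<close>
  from haxell_step[OF fin r _ _ M0, of "[]"] R
  obtain M xs where M: "indep_transversal cls adj {v\<in>U. cls v \<in> R - {r}} M"
    and xs: "star_forest cls adj U r M xs"
    and dom: "\<forall>v\<in>U. cls v \<in> insert r (cls ` leaves adj M xs) \<longrightarrow> (\<exists>d \<in> set xs \<union> leaves adj M xs. adj v d)"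
    by (auto simp: bad_def)
  have MU: "M \<subseteq> U" and rM: "r \<notin> cls ` M" and injM: "inj_on cls M"
    using M by (auto simp: indep_transversal_def)
  have finM: "finite M" using MU fin finite_subset by blast
  have lM: "leaves adj M xs \<subseteq> M" by (auto simp: leaves_def)
  have finL: "finite (leaves adj M xs)" using lM finM finite_subset by blast
  have inj: "inj_on cls (leaves adj M xs)" using injM lM inj_on_subset by blast
  have xsU: "set xs \<subseteq> U" using xs by (induction xs) auto
  have rU: "r \<in> cls ` U" using r R by (auto simp: bad_def)
  have cI: "card (leaves adj M xs) < card (insert r (cls ` leaves adj M xs))"
  proof -
    have "r \<notin> cls ` leaves adj M xs" using rM lM by blast
    then show ?thesis using finL inj by (simp add: card_image)
  qed
  have cX: "card (set xs) \<le> card (leaves adj M xs)"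
    using star_forest_length_le[OF finM xs] card_length[of xs] by linarith
  show thesis
  proof (rule that[of "leaves adj M xs" "set xs" "insert r (cls ` leaves adj M xs)"])
    show "\<exists>c. {x \<in> set xs. adj y x} = {c}" if "y \<in> leaves adj M xs" for y
    proof -
      have "{x \<in> set xs. adj y x} = {x \<in> set xs. adj x y}" by (simp add: adj_commute)
      then show ?thesis using star_forest_unique_centre[OF xs that] by simp
    qed
    show "\<not> adj u v" if "u \<in> leaves adj M xs" "v \<in> leaves adj M xs" for u v
      using that M lM unfolding indep_transversal_def by blast
  qed (use lM MU xsU inj rU cI cX dom in auto)
qed

end

section \<open>Weighted and fractional versions\<close>

text \<open>Serves to choose a transversal that is optimal for the lowered weights, then for the
  original ones, then for its overlap with the leaves.\<close>

lemma lex_max: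
  fixes f g h :: "'a \<Rightarrow> int"
  assumes "finite A" "A \<noteq> {}"
  obtains m where "m \<in> A" "\<And>x. x \<in> A \<Longrightarrow> f x \<le> f m"
    "\<And>x. x \<in> A \<Longrightarrow> f x = f m \<Longrightarrow> g x \<le> g m"
    "\<And>x. x \<in> A \<Longrightarrow> f x = f m \<Longrightarrow> g x = g m \<Longrightarrow> h x \<le> h m"
proof -
  have max: "\<exists>m\<in>B. \<forall>x\<in>B. k x \<le> k m" if "finite B" "B \<noteq> {}" for B :: "'a set" and k :: "'a \<Rightarrow> int"
  proof -
    have "Max (k ` B) \<in> k ` B" using that by simp
    then obtain m where "m \<in> B" "k m = Max (k ` B)" by auto
    moreover have "\<forall>x\<in>B. k x \<le> Max (k ` B)" using that by simp
    ultimately show ?thesis by metis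
  qed
  obtain a where a: "a \<in> A" "\<forall>x\<in>A. f x \<le> f a" using max assms by blast
  obtain b where b: "b \<in> A" "f b = f a" "\<forall>x\<in>{x\<in>A. f x = f a}. g x \<le> g b"
    using max[of "{x\<in>A. f x = f a}" g] a assms by auto
  obtain c where c: "c \<in> A" "f c = f a" "g c = g b" "\<forall>x\<in>{x\<in>A. f x = f a \<and> g x = g b}. h x \<le> h c"
    using max[of "{x\<in>A. f x = f a \<and> g x = g b}" h] b assms by auto
  show thesis by (rule that[of c]) (use a b c in auto)
qed

context partitioned_graph
begin

lemma transversal_swap:
  assumes M: "indep_transversal cls adj Q M" and m: "m \<in> M" and y: "y \<in> Q" "cls y = cls m"
    and free: "\<And>v. v \<in> M \<Longrightarrow> \<not> adj y v"
  shows "indep_transversal cls adj Q (insert y (M - {m}))"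
  unfolding indep_transversal_def
proof (intro conjI)
  have inj: "inj_on cls M" using M by (simp add: indep_transversal_def)
  have "cls y \<notin> cls ` (M - {m})" using inj m y(2) unfolding inj_on_def by auto
  moreover have "inj_on cls (M - {m})" using inj by (meson Diff_subset inj_on_subset)
  ultimately show "inj_on cls (insert y (M - {m}))" unfolding inj_on_insert by blast
  show "cls ` insert y (M - {m}) = cls ` Q"
    using M m y(2) unfolding indep_transversal_def by (metis image_insert insert_Diff)
  show "insert y (M - {m}) \<subseteq> Q" using M y(1) by (auto simp: indep_transversal_def)
  have "\<And>v. v \<in> M \<Longrightarrow> \<not> adj v y" using free adj_commute by simp
  then show "\<forall>u\<in>insert y (M - {m}). \<forall>v\<in>insert y (M - {m}). \<not> adj u v"
    using M free adj_irrefl unfolding indep_transversal_def by auto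
qed

text \<open>
  The induction is on the slack \<open>\<Sum>(max of the part - w v)\<close>. If the vertices of maximum weight in
  their parts have no independent transversal, Haxell's dominating set \<open>D = X \<union> L\<close> is used to lower
  \<open>w\<close> by the number of neighbours in \<open>D\<close>. Since every leaf has a single neighbour in \<open>D\<close>, a suitably
  tie-broken optimal transversal for the lowered weights has at least \<open>|L|\<close> edges to \<open>D\<close>.
\<close>

lemma weighted_transversal:
  fixes w :: "'a \<Rightarrow> int"
  assumes fin: "finite Q" and deg: "\<And>u. u \<in> Q \<Longrightarrow> card {v\<in>Q. adj u v} \<le> k"
    and size: "\<And>i. i \<in> cls ` Q \<Longrightarrow> card {v\<in>Q. cls v = i} = 2 * k" and k: "0 < k"
  shows "\<exists>M. indep_transversal cls adj Q M \<and> sum w Q \<le> 2 * int k * sum w M"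
proof -
  define mx where "mx w i = Max (w ` {v\<in>Q. cls v = i})" for w :: "'a \<Rightarrow> int" and i
  define slack where "slack w = (\<Sum>v\<in>Q. mx w (cls v) - w v)" for w
  have mx_ge: "w v \<le> mx w (cls v)" if "v \<in> Q" for w v
    unfolding mx_def using that fin by (intro Max_ge) auto
  have mx_in: "\<exists>v\<in>Q. cls v = i \<and> w v = mx w i" if "i \<in> cls ` Q" for w i
  proof -
    have "mx w i \<in> w ` {v\<in>Q. cls v = i}" unfolding mx_def using that fin by (intro Max_in) auto
    then show ?thesis by auto
  qed
  have slack_nonneg: "0 \<le> slack w" for w
    unfolding slack_def using mx_ge by (intro sum_nonneg) simp
  have sum_Q: "(\<Sum>v\<in>Q. g (cls v)) = 2 * int k * (\<Sum>i\<in>cls ` Q. g i)" for g :: "'b \<Rightarrow> int"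
  proof -
    have "(\<Sum>v\<in>Q. g (cls v)) = (\<Sum>i\<in>cls ` Q. \<Sum>v\<in>{v\<in>Q. cls v = i}. g (cls v))"
      by (rule sum.image_gen[OF fin])
    also have "\<dots> = (\<Sum>i\<in>cls ` Q. 2 * int k * g i)"
    proof (rule sum.cong[OF refl])
      fix i assume "i \<in> cls ` Q"
      then show "(\<Sum>v\<in>{v\<in>Q. cls v = i}. g (cls v)) = 2 * int k * g i" by (simp add: size)
    qed
    finally show ?thesis by (simp add: sum_distrib_left)
  qed
  show ?thesis
  proof (induction "nat (slack w)" arbitrary: w rule: less_induct)
    case less
    define U where "U = {v\<in>Q. w v = mx w (cls v)}"
    have UQ: "U \<subseteq> Q" by (auto simp: U_def)
    have finU: "finite U" using fin UQ finite_subset by blast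
    have clsU: "cls ` U = cls ` Q"
      using mx_in unfolding U_def by (auto simp: image_iff) metis
    show ?case
    proof (cases "\<exists>M. indep_transversal cls adj U M")
      case True
      then obtain M where M: "indep_transversal cls adj U M" by blast
      have "sum w Q \<le> (\<Sum>v\<in>Q. mx w (cls v))" using mx_ge by (intro sum_mono)
      also have "\<dots> = 2 * int k * (\<Sum>i\<in>cls ` M. mx w i)"
        using M clsU by (simp add: sum_Q indep_transversal_def)
      also have "(\<Sum>i\<in>cls ` M. mx w i) = (\<Sum>v\<in>M. mx w (cls v))"
        using M sum.reindex[of cls M "mx w"] unfolding indep_transversal_def comp_def by metis
      also have "\<dots> = sum w M"
        using M by (intro sum.cong) (auto simp: indep_transversal_def U_def)
      finally have "sum w Q \<le> 2 * int k * sum w M" .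
      moreover have "indep_transversal cls adj Q M"
        using M clsU UQ by (auto simp: indep_transversal_def)
      ultimately show ?thesis by blast
    next
      case False
      obtain L X I where LU: "L \<subseteq> U" and XU: "X \<subseteq> U" and injL: "inj_on cls L"
        and IU: "I \<subseteq> cls ` U" and LI: "cls ` L \<subseteq> I"
        and cLI: "card L < card I" and cXL: "card X \<le> card L"
        and Lind: "\<And>u v. u \<in> L \<Longrightarrow> v \<in> L \<Longrightarrow> \<not> adj u v"
        and Lc: "\<And>y. y \<in> L \<Longrightarrow> \<exists>c. {x\<in>X. adj y x} = {c}"
        and dom: "\<And>v. v \<in> U \<Longrightarrow> cls v \<in> I \<Longrightarrow> \<exists>d \<in> X \<union> L. adj v d"
        by (rule haxell_dichotomy[OF finU False]) (rule that; assumption)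
      define D where "D = X \<union> L"
      define c where "c v = card {d\<in>D. adj v d}" for v
      define w' where "w' v = w v - int (c v)" for v
      have finD: "finite D" using LU XU finU unfolding D_def by (meson finite_Un finite_subset)
      have DQ: "D \<subseteq> Q" using LU XU UQ by (auto simp: D_def)
      have cardD: "card D \<le> 2 * card L" using card_Un_le[of X L] cXL by (simp add: D_def)
      have c_pos: "1 \<le> c v" if "v \<in> U" "cls v \<in> I" for v
      proof -
        have "{d\<in>D. adj v d} \<noteq> {}" using dom[OF that] by (auto simp: D_def)
        then have "card {d\<in>D. adj v d} > 0" using finD by (simp add: card_gt_0_iff)
        then show ?thesis by (simp add: c_def)
      qed
      have c_leaf: "c y = 1" if y: "y \<in> L" for y
      proof -
        have "{d\<in>D. adj y d} = {x\<in>X. adj y x}" using Lind[OF y] by (auto simp: D_def)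
        then show ?thesis using Lc[OF y] by (auto simp: c_def)
      qed
      \<comment> \<open>Double counting: \<open>D\<close> has at most \<open>2 * card L\<close>
        members, each with at most \<open>k\<close> neighbours in \<open>Q\<close>.\<close>
      have sum_c: "(\<Sum>v\<in>Q. int (c v)) \<le> 2 * int k * int (card L)"
      proof -
        have "(\<Sum>v\<in>Q. c v) = (\<Sum>d\<in>D. card {v\<in>Q. adj v d})"
          unfolding c_def by (rule sum_multicount_gen) (use fin finD in auto)
        also have "\<dots> \<le> (\<Sum>d\<in>D. k)"
        proof (rule sum_mono)
          fix d assume "d \<in> D"
          moreover have "{v\<in>Q. adj v d} = {v\<in>Q. adj d v}" using adj_commute by blast
          ultimately show "card {v\<in>Q. adj v d} \<le> k" using deg DQ by auto
        qed
        also have "\<dots> \<le> 2 * k * card L" using cardD by simp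
        finally have "int (\<Sum>v\<in>Q. c v) \<le> int (2 * k * card L)" by (simp only: of_nat_le_iff)
        then show ?thesis by simp
      qed
      \<comment> \<open>In a part of \<open>I\<close>, a vertex of maximum weight is dominated and
        loses at least 1, and any other was, by integrality, at least 1 below the maximum
        before.\<close>
      have mx': "mx w' i \<le> mx w i - of_bool (i \<in> I)" if i: "i \<in> cls ` Q" for i
      proof -
        obtain v where v: "v \<in> Q" "cls v = i" "w' v = mx w' i" using mx_in[OF i] by blast
        have "w' v \<le> mx w i - of_bool (i \<in> I)"
        proof (cases "v \<in> U")
          case True
          then show ?thesis using c_pos[of v] v(2) by (auto simp: w'_def U_def)
        next
          case False
          then have "w v < mx w i" using mx_ge[OF v(1), of w] v(1,2) by (auto simp: U_def)
          then show ?thesis by (simp add: w'_def)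
        qed
        then show ?thesis using v(3) by simp
      qed
      \<comment> \<open>The maxima, summed over \<open>Q\<close>, fall by at least
        \<open>2 * k * card I\<close>, the total weight by at most \<open>2 * k * card L\<close>,
        which is less.\<close>
      have "slack w' < slack w"
      proof -
        have "(\<Sum>v\<in>Q. mx w' (cls v)) \<le> (\<Sum>v\<in>Q. mx w (cls v) - of_bool (cls v \<in> I))"
          using mx' by (intro sum_mono) blast
        also have "\<dots> = (\<Sum>v\<in>Q. mx w (cls v)) - 2 * int k * (\<Sum>i\<in>cls ` Q. of_bool (i \<in> I))"
          by (simp add: sum_subtractf sum_Q[of "\<lambda>i. of_bool (i \<in> I)"])
        also have "(\<Sum>i\<in>cls ` Q. of_bool (i \<in> I)) = int (card I)"
          using IU clsU fin by (simp add: of_bool_def sum.If_cases Int_absorb1)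
        finally have "(\<Sum>v\<in>Q. mx w' (cls v)) \<le> (\<Sum>v\<in>Q. mx w (cls v)) - 2 * int k * int (card I)" .
        moreover have "2 * int k * int (card L) < 2 * int k * int (card I)" using cLI k by simp
        moreover have "(\<Sum>v\<in>Q. w' v) = sum w Q - (\<Sum>v\<in>Q. int (c v))"
          by (simp add: w'_def sum_subtractf)
        ultimately show ?thesis using sum_c by (simp add: slack_def sum_subtractf)
      qed
      then have "nat (slack w') < nat (slack w)" using slack_nonneg[of w'] by linarith
      from less.hyps[OF this] obtain M0 where
        M0: "indep_transversal cls adj Q M0" "sum w' Q \<le> 2 * int k * sum w' M0" by blast
      have "finite {M. indep_transversal cls adj Q M}"
        by (rule finite_subset[of _ "Pow Q"]) (use fin in \<open>auto simp: indep_transversal_def\<close>)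
      moreover have "{M. indep_transversal cls adj Q M} \<noteq> {}" using M0 by blast
      ultimately obtain M where M: "M \<in> Collect (indep_transversal cls adj Q)"
        and opt0: "\<And>N. N \<in> Collect (indep_transversal cls adj Q) \<Longrightarrow> sum w' N \<le> sum w' M"
        "\<And>N. N \<in> Collect (indep_transversal cls adj Q) \<Longrightarrow> sum w' N = sum w' M \<Longrightarrow> sum w N \<le> sum w M"
        "\<And>N. N \<in> Collect (indep_transversal cls adj Q) \<Longrightarrow> sum w' N = sum w' M \<Longrightarrow> sum w N = sum w M
            \<Longrightarrow> int (card (L \<inter> N)) \<le> int (card (L \<inter> M))"
        by (rule lex_max[where f = "sum w'" and g = "sum w" and h = "\<lambda>N. int (card (L \<inter> N))"])
          (rule that; assumption)
      from M have M: "indep_transversal cls adj Q M" by simp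
      note opt = opt0[OF CollectI]
      have MQ: "M \<subseteq> Q" using M by (simp add: indep_transversal_def)
      have finM: "finite M" using MQ fin finite_subset by blast
      \<comment> \<open>Otherwise \<open>y\<close> could replace the representative \<open>m\<close>
        of its part. As \<open>y\<close> loses exactly 1, the lowered weight would not decrease, and
        one of the two tie-breaks would improve.\<close>
      have hit: "\<exists>v\<in>M. adj y v" if y: "y \<in> L" and yM: "y \<notin> M" for y
      proof (rule ccontr)
        assume free: "\<not> (\<exists>v\<in>M. adj y v)"
        have yQ: "y \<in> Q" and yU: "y \<in> U" using y LU UQ by auto
        obtain m where m: "m \<in> M" "cls y = cls m"
          using M yQ unfolding indep_transversal_def by (metis image_eqI imageE)
        have mQ: "m \<in> Q" using m MQ by blast
        define N where "N = insert y (M - {m})"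
        have N: "indep_transversal cls adj Q N"
          unfolding N_def using free by (intro transversal_swap[OF M m(1) yQ m(2)]) blast
        have sumN: "sum f N = sum f M - f m + f y" for f :: "'a \<Rightarrow> int"
          unfolding N_def using finM m(1) yM by (simp add: sum_diff1)
        have w'y: "w' y = w y - 1" using c_leaf[OF y] by (simp add: w'_def)
        have w'm: "w' y \<le> w' m" using opt(1)[OF N] sumN[of w'] by simp
        have wy: "w y = mx w (cls m)" using yU m(2) by (simp add: U_def)
        show False
        proof (cases "m \<in> U")
          case True
          then have wm: "w m = w y" using wy by (simp add: U_def)
          \<comment> \<open>Here \<open>m\<close> has the weight of \<open>y\<close> and loses at
            least as much, so both weights tie and the overlap with \<open>L\<close> decides:
            \<open>m\<close> is not a leaf because \<open>L\<close> has at most one vertex per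
            part.\<close>
          have "1 \<le> c m" using c_pos[OF True] y LI m(2) by auto
          then have "w' m = w' y" using w'm w'y wm by (simp add: w'_def)
          then have "int (card (L \<inter> N)) \<le> int (card (L \<inter> M))"
            using opt(3)[OF N] sumN[of w] sumN[of w'] wm by simp
          moreover have "m \<notin> L" using injL y m yM unfolding inj_on_def by metis
          then have "L \<inter> N = insert y (L \<inter> M)" using y by (auto simp: N_def)
          then have "card (L \<inter> N) = Suc (card (L \<inter> M))" using yM finM by simp
          ultimately show False by simp
        next
          case False
          \<comment> \<open>Here \<open>m\<close> weighs at least 1 less than \<open>y\<close>, so
            the lowered weights can only tie, and the swap raises the original weight.\<close>
          then have "w m < w y" using mx_ge[OF mQ, of w] mQ wy by (auto simp: U_def)
          then have "w' m = w' y" "w m = w y - 1" using w'm w'y by (auto simp: w'_def)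
          then show False using opt(2)[OF N] sumN[of w] sumN[of w'] by simp
        qed
      qed
      have "card L \<le> (\<Sum>v\<in>M. c v)"
      proof -
        define centre where "centre y = (SOME x. x \<in> X \<and> adj y x)" for y
        define nb where "nb y = (SOME v. v \<in> M \<and> adj y v)" for y
        have centre: "centre y \<in> X \<and> adj y (centre y)" if "y \<in> L" for y
        proof -
          have "\<exists>x. x \<in> X \<and> adj y x" using Lc[OF that] by blast
          then show ?thesis unfolding centre_def by (rule someI_ex)
        qed
        have nb: "nb y \<in> M \<and> adj (nb y) y" if "y \<in> L" "y \<notin> M" for y
        proof -
          have "\<exists>v. v \<in> M \<and> adj y v" using hit[OF that] by blast
          then have "nb y \<in> M \<and> adj y (nb y)" unfolding nb_def by (rule someI_ex)
          then show ?thesis by (simp add: adj_commute)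
        qed
        \<comment> \<open>One edge from \<open>M\<close> to \<open>D\<close> per leaf: a leaf in
          \<open>M\<close> supplies the edge to its centre, any other leaf the edge from a neighbour
          in \<open>M\<close>. Edges of the two kinds cannot coincide, since such an edge would join
          two leaves.\<close>
        define e where "e y = (if y \<in> M then (y, centre y) else (nb y, y))" for y
        have "inj_on e L"
        proof (rule inj_onI)
          fix y z assume yz: "y \<in> L" "z \<in> L" "e y = e z"
          then show "y = z"
            using centre[OF yz(1)] centre[OF yz(2)] Lind[OF yz(1,2)] Lind[OF yz(2,1)]
            by (auto simp: e_def split: if_splits)
        qed
        moreover have "e ` L \<subseteq> (SIGMA v:M. {d\<in>D. adj v d})"
          using centre nb by (auto simp: e_def D_def)
        moreover have "finite (SIGMA v:M. {d\<in>D. adj v d})" using finM finD by simp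
        ultimately have "card L \<le> card (SIGMA v:M. {d\<in>D. adj v d})" by (rule card_inj_on_le)
        also have "\<dots> = (\<Sum>v\<in>M. c v)" unfolding c_def using finM finD by (simp add: card_SigmaI)
        finally show ?thesis .
      qed
      then have "int (card L) \<le> (\<Sum>v\<in>M. int (c v))" by (simp flip: of_nat_sum)
      then have "2 * int k * int (card L) \<le> 2 * int k * (\<Sum>v\<in>M. int (c v))"
        by (intro mult_left_mono) auto
      moreover have "sum w' Q \<le> 2 * int k * sum w' M"
        using M0(2) mult_left_mono[OF opt(1)[OF M0(1)], of "2 * int k"] by simp
      moreover have "sum w' Q = sum w Q - (\<Sum>v\<in>Q. int (c v))" "sum w' M = sum w M - (\<Sum>v\<in>M. int (c v))"
        by (simp_all add: w'_def sum_subtractf)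
      \<comment> \<open>Undoing the lowering adds at most \<open>2 * k * card L\<close> on the left
        and at least \<open>2 * k * card L\<close> on the right.\<close>
      ultimately have "sum w Q \<le> 2 * int k * sum w M"
        using sum_c by (simp add: right_diff_distrib)
      then show ?thesis using M by blast
    qed
  qed
qed

text \<open>Duality gives only "at least". A transversal meets each part once, so the probabilities
  of the \<open>2 * k\<close> vertices of a part sum to 1 and every inequality is tight.\<close>

lemma fractional_transversal:
  assumes fin: "finite Q" and deg: "\<And>u. u \<in> Q \<Longrightarrow> card {v\<in>Q. adj u v} \<le> k"
    and size: "\<And>i. i \<in> cls ` Q \<Longrightarrow> card {v\<in>Q. cls v = i} = 2 * k" and k: "0 < k"
  shows "\<exists>l. (\<forall>M\<in>Collect (indep_transversal cls adj Q). 0 \<le> l M) \<and>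
      (\<Sum>M\<in>Collect (indep_transversal cls adj Q). l M) = (1 :: rat) \<and>
      (\<forall>v\<in>Q. (\<Sum>M\<in>{M\<in>Collect (indep_transversal cls adj Q). v \<in> M}. l M) = 1 / (2 * of_nat k))"
proof -
  let ?F = "Collect (indep_transversal cls adj Q)"
  have finF: "finite ?F"
    by (rule finite_subset[of _ "Pow Q"]) (use fin in \<open>auto simp: indep_transversal_def\<close>)
  have "\<exists>M\<in>?F. (\<Sum>v\<in>Q. of_int (w v) * (1 / (2 * of_nat k))) \<le> (\<Sum>v\<in>Q \<inter> M. of_int (w v) :: rat)"
    for w :: "'a \<Rightarrow> int"
  proof -
    obtain M where M: "indep_transversal cls adj Q M" "sum w Q \<le> 2 * int k * sum w M"
      using weighted_transversal[OF fin deg size k] by blast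
    then have QM: "Q \<inter> M = M" by (auto simp: indep_transversal_def)
    have "of_int (sum w Q) \<le> (of_int (2 * int k * sum w M) :: rat)" using M(2) by (simp only: of_int_le_iff)
    then have "of_int (sum w Q) / (2 * of_nat k) \<le> (of_int (sum w M) :: rat)"
      using k by (simp add: field_simps)
    then have "(\<Sum>v\<in>Q. of_int (w v) * (1 / (2 * of_nat k))) \<le> (\<Sum>v\<in>Q \<inter> M. of_int (w v) :: rat)"
      by (simp add: QM flip: sum_divide_distrib)
    then show ?thesis using M(1) by blast
  qed
  from fractional_cover[OF finF fin this]
  obtain l where l: "\<forall>M\<in>?F. 0 \<le> l M" "sum l ?F = (1 :: rat)"
    "\<forall>v\<in>Q. 1 / (2 * of_nat k) \<le> (\<Sum>M\<in>{M\<in>?F. v \<in> M}. l M)" by blast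
  have "(\<Sum>M\<in>{M\<in>?F. v \<in> M}. l M) = 1 / (2 * of_nat k)" if v: "v \<in> Q" for v
  proof -
    define P where "P = {u\<in>Q. cls u = cls v}"
    have finP: "finite P" using fin by (simp add: P_def)
    have cardP: "card P = 2 * k" unfolding P_def by (rule size) (use v in simp)
    have "(\<Sum>u\<in>P. \<Sum>M\<in>{M\<in>?F. u \<in> M}. l M) = (\<Sum>M\<in>?F. \<Sum>u\<in>{u\<in>P. u \<in> M}. l M)"
      using finP finF by (rule sum.swap_restrict)
    also have "\<dots> = (\<Sum>M\<in>?F. l M)"
    proof (rule sum.cong[OF refl])
      fix M assume "M \<in> ?F"
      then have M: "M \<subseteq> Q" "inj_on cls M" "cls ` M = cls ` Q" by (auto simp: indep_transversal_def)
      have "cls v \<in> cls ` M" using M(3) v by simp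
      then obtain m where m: "m \<in> M" "cls m = cls v" by auto
      have "u = m" if "u \<in> M" "cls u = cls v" for u using M(2) m that unfolding inj_on_def by metis
      then have "{u\<in>P. u \<in> M} = {m}" using M(1) m unfolding P_def by blast
      then show "(\<Sum>u\<in>{u\<in>P. u \<in> M}. l M) = l M" by simp
    qed
    also have "\<dots> = 1" by (rule l(2))
    also have "1 = (\<Sum>u\<in>P. 1 / (2 * of_nat k) :: rat)" using cardP k by simp
    finally have eq: "(\<Sum>u\<in>P. 1 / (2 * of_nat k)) = (\<Sum>u\<in>P. \<Sum>M\<in>{M\<in>?F. u \<in> M}. l M)" ..
    have le: "1 / (2 * of_nat k) \<le> (\<Sum>M\<in>{M\<in>?F. u \<in> M}. l M)" if "u \<in> P" for u
      using l(3) that unfolding P_def by blast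
    have "v \<in> P" using v by (simp add: P_def)
    then show ?thesis using sum_mono_inv[OF eq le _ finP] by metis
  qed
  then show ?thesis using l(1,2) by (intro exI[of _ l]) simp
qed

end

section \<open>The fractional Caro--Wei bound\<close>

lemma weighted_caro_wei:
  fixes w :: "'a \<Rightarrow> rat"
  assumes "finite A" and sym: "\<And>u v. adj u v \<Longrightarrow> adj v u" and irr: "\<And>v. \<not> adj v v"
    and w: "\<And>v. 0 \<le> w v"
  shows "\<exists>B\<subseteq>A. (\<forall>u\<in>B. \<forall>v\<in>B. \<not> adj u v) \<and>
      (\<Sum>v\<in>A. w v / (of_nat (card {u\<in>A. adj v u}) + 1)) \<le> sum w B"
  using assms(1)
proof (induction A rule: finite_psubset_induct)
  case (psubset A)
  define t where "t v = w v / (of_nat (card {u\<in>A. adj v u}) + 1)" for v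
  show ?case
  proof (cases "A = {}")
    case False
    \<comment> \<open>Averaging: summed over \<open>v\<close>, the left sides count
      \<open>t u\<close> once for each of the \<open>deg u + 1\<close> members of the closed
      neighbourhood of \<open>u\<close>, in total \<open>w u\<close>. Taking such a \<open>v\<close>
      and deleting its closed neighbourhood pays for the deleted terms, and the remaining degrees
      only drop.\<close>
    have "\<exists>v\<in>A. (\<Sum>u\<in>{u\<in>A. u = v \<or> adj v u}. t u) \<le> w v"
    proof (rule ccontr)
      assume "\<not> ?thesis"
      then have "(\<Sum>v\<in>A. w v) < (\<Sum>v\<in>A. \<Sum>u\<in>{u\<in>A. u = v \<or> adj v u}. t u)"
        using psubset.hyps False by (intro sum_strict_mono) (auto simp: not_le)
      also have "\<dots> = (\<Sum>u\<in>A. \<Sum>v\<in>{v\<in>A. u = v \<or> adj v u}. t u)"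
        using psubset.hyps by (intro sum.swap_restrict)
      also have "\<dots> = (\<Sum>u\<in>A. w u)"
      proof (rule sum.cong[OF refl])
        fix u assume u: "u \<in> A"
        have "{v\<in>A. u = v \<or> adj v u} = insert u {v\<in>A. adj u v}" using sym u by blast
        moreover have "u \<notin> {v\<in>A. adj u v}" using irr by blast
        ultimately have "card {v\<in>A. u = v \<or> adj v u} = card {v\<in>A. adj u v} + 1"
          using psubset.hyps by simp
        moreover have "of_nat (card {v\<in>A. adj u v}) + 1 \<noteq> (0 :: rat)"
          by (metis of_nat_Suc of_nat_neq_0 add.commute)
        ultimately show "(\<Sum>v\<in>{v\<in>A. u = v \<or> adj v u}. t u) = w u"
          by (simp add: t_def add.commute)
      qed
      finally show False by simp
    qed
    then obtain v where v: "v \<in> A" "(\<Sum>u\<in>{u\<in>A. u = v \<or> adj v u}. t u) \<le> w v" by blast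
    define A' where "A' = {u\<in>A. \<not> (u = v \<or> adj v u)}"
    have A': "A' \<subset> A" using v(1) by (auto simp: A'_def)
    from psubset.IH[OF this] obtain B where B: "B \<subseteq> A'" "\<forall>u\<in>B. \<forall>v\<in>B. \<not> adj u v"
      "(\<Sum>v\<in>A'. w v / (of_nat (card {u\<in>A'. adj v u}) + 1)) \<le> sum w B" by blast
    have finB: "finite B" using B(1) A' psubset.hyps by (meson finite_subset psubset_imp_subset)
    have "(\<Sum>u\<in>A'. t u) \<le> (\<Sum>v\<in>A'. w v / (of_nat (card {u\<in>A'. adj v u}) + 1))"
    proof (rule sum_mono)
      fix u assume "u \<in> A'"
      have "card {x\<in>A'. adj u x} \<le> card {x\<in>A. adj u x}"
        using psubset.hyps A' by (intro card_mono) auto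
      then show "t u \<le> w u / (of_nat (card {x\<in>A'. adj u x}) + 1)"
        unfolding t_def using w[of u] by (intro divide_left_mono) (auto simp: add_pos_nonneg intro!: mult_pos_pos add_nonneg_pos)
    qed
    moreover have "(\<Sum>u\<in>A. t u) = (\<Sum>u\<in>{u\<in>A. u = v \<or> adj v u}. t u) + (\<Sum>u\<in>A'. t u)"
      unfolding A'_def using psubset.hyps
      by (subst sum.union_disjoint[symmetric]) (auto intro!: sum.cong)
    moreover have "v \<notin> B" using B(1) by (auto simp: A'_def)
    ultimately have "(\<Sum>u\<in>A. t u) \<le> sum w (insert v B)" using v(2) B(3) finB by simp
    moreover have "insert v B \<subseteq> A" using v(1) B(1) A' by auto
    moreover have "\<forall>x\<in>B. \<not> adj v x" using B(1) by (auto simp: A'_def)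
    then have "\<forall>x\<in>insert v B. \<forall>y\<in>insert v B. \<not> adj x y" using B(2) irr sym by blast
    ultimately show ?thesis unfolding t_def by blast
  qed simp
qed

lemma fractional_caro_wei:
  assumes fin: "finite A" and sym: "\<And>u v. adj u v \<Longrightarrow> adj v u" and irr: "\<And>v. \<not> adj v v"
  shows "\<exists>l. (\<forall>B\<in>{B. B \<subseteq> A \<and> (\<forall>u\<in>B. \<forall>v\<in>B. \<not> adj u v)}. 0 \<le> l B) \<and>
      (\<Sum>B\<in>{B. B \<subseteq> A \<and> (\<forall>u\<in>B. \<forall>v\<in>B. \<not> adj u v)}. l B) = (1 :: rat) \<and>
      (\<forall>v\<in>A. 1 / (of_nat (card {u\<in>A. adj v u}) + 1) \<le>
        (\<Sum>B\<in>{B\<in>{B. B \<subseteq> A \<and> (\<forall>u\<in>B. \<forall>v\<in>B. \<not> adj u v)}. v \<in> B}. l B))"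
proof (rule fractional_cover[OF _ fin])
  show "finite {B. B \<subseteq> A \<and> (\<forall>u\<in>B. \<forall>v\<in>B. \<not> adj u v)}" using fin by simp
  fix w :: "'a \<Rightarrow> int" assume w: "\<And>v. 0 \<le> w v"
  have "\<exists>B\<subseteq>A. (\<forall>u\<in>B. \<forall>v\<in>B. \<not> adj u v) \<and>
      (\<Sum>v\<in>A. of_int (w v) / (of_nat (card {u\<in>A. adj v u}) + 1)) \<le> (\<Sum>v\<in>B. of_int (w v) :: rat)"
    by (rule weighted_caro_wei[OF fin sym irr]) (use w in auto)
  then obtain B where B: "B \<subseteq> A" "\<forall>u\<in>B. \<forall>v\<in>B. \<not> adj u v"
    "(\<Sum>v\<in>A. of_int (w v) / (of_nat (card {u\<in>A. adj v u}) + 1)) \<le> (\<Sum>v\<in>B. of_int (w v) :: rat)" by blast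
  moreover have "A \<inter> B = B" using B(1) by blast
  ultimately show "\<exists>B\<in>{B. B \<subseteq> A \<and> (\<forall>u\<in>B. \<forall>v\<in>B. \<not> adj u v)}.
      (\<Sum>v\<in>A. of_int (w v) * (1 / (of_nat (card {u\<in>A. adj v u}) + 1))) \<le> (\<Sum>v\<in>A \<inter> B. of_int (w v) :: rat)"
    by (intro bexI[of _ B]) auto
qed

section \<open>Random subsets of the parts\<close>

lemma card_subsets_containing:
  assumes "finite C" "a \<in> C" "0 < m"
  shows "card {S. S \<subseteq> C \<and> card S = m \<and> a \<in> S} = (card C - 1) choose (m - 1)"
proof -
  have "{S. S \<subseteq> C \<and> card S = m \<and> a \<in> S} = insert a ` {S. S \<subseteq> C - {a} \<and> card S = m - 1}"
  proof (intro equalityI subsetI)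
    fix S assume "S \<in> {S. S \<subseteq> C \<and> card S = m \<and> a \<in> S}"
    then have "S = insert a (S - {a})" "S - {a} \<subseteq> C - {a}" "card (S - {a}) = m - 1"
      using assms(1) by (auto simp: finite_subset)
    then show "S \<in> insert a ` {S. S \<subseteq> C - {a} \<and> card S = m - 1}" by blast
  next
    fix S assume "S \<in> insert a ` {S. S \<subseteq> C - {a} \<and> card S = m - 1}"
    then obtain S' where S': "S = insert a S'" "S' \<subseteq> C - {a}" "card S' = m - 1" by blast
    then have "finite S'" "a \<notin> S'" using assms(1) by (auto intro: finite_subset)
    then show "S \<in> {S. S \<subseteq> C \<and> card S = m \<and> a \<in> S}" using S' assms by auto
  qed
  moreover have "inj_on (insert a) {S. S \<subseteq> C - {a} \<and> card S = m - 1}"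
    by (rule inj_onI) (auto simp: insert_ident)
  ultimately show ?thesis using assms(1,2) by (simp add: card_image n_subsets)
qed

text \<open>\<open>A\<close> has a single vertex \<open>a\<close> in \<open>C\<close>, so the event
  is \<open>a \<in> S\<close>. For neighbourhoods, this is where attachment to a clique by at most
  one edge enters.\<close>

lemma uniform_subset_bernoulli:
  assumes "finite C" "0 < m" "m \<le> card C" "C \<inter> A = {a}"
  shows "map_pmf (\<lambda>S. S \<inter> A \<noteq> {}) (pmf_of_set {S. S \<subseteq> C \<and> card S = m})
    = bernoulli_pmf (real m / real (card C))"
proof -
  let ?M = "{S. S \<subseteq> C \<and> card S = m}"
  have aC: "a \<in> C" using assms(4) by blast
  have fin: "finite ?M" using assms(1) by simp
  have card: "card ?M = card C choose m" using assms(1) by (rule n_subsets)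
  then have pos: "0 < card ?M" using assms(3) by simp
  then have ne: "?M \<noteq> {}" by (metis card.empty less_irrefl)
  have p: "0 \<le> real m / real (card C)" "real m / real (card C) \<le> 1" using assms(2,3) by auto
  have "?M \<inter> (\<lambda>S. S \<inter> A \<noteq> {}) -` {True} = {S. S \<subseteq> C \<and> card S = m \<and> a \<in> S}"
    using assms(4) by auto
  then have "pmf (map_pmf (\<lambda>S. S \<inter> A \<noteq> {}) (pmf_of_set ?M)) True
      = real ((card C - 1) choose (m - 1)) / real (card C choose m)"
    by (simp add: pmf_map measure_pmf_of_set[OF ne fin] card card_subsets_containing[OF assms(1) aC assms(2)])
  also have "\<dots> = real m / real (card C)"
  proof -
    have "m * (card C choose m) = card C * ((card C - 1) choose (m - 1))"
      using binomial_absorption[of "m - 1" "card C"] assms(2) by simp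
    then have "real m * real (card C choose m) = real (card C) * real ((card C - 1) choose (m - 1))"
      by (metis of_nat_mult)
    moreover have "0 < card C choose m" "0 < card C" using assms(2,3) by auto
    ultimately show ?thesis by (simp add: field_simps)
  qed
  finally have T: "pmf (map_pmf (\<lambda>S. S \<inter> A \<noteq> {}) (pmf_of_set ?M)) True = real m / real (card C)" .
  show ?thesis
  proof (rule pmf_eqI)
    fix b
    show "pmf (map_pmf (\<lambda>S. S \<inter> A \<noteq> {}) (pmf_of_set ?M)) b = pmf (bernoulli_pmf (real m / real (card C))) b"
      using T p by (cases b) (simp_all add: pmf_False_conv_True)
  qed
qed

text \<open>Choice functions with default \<open>{}\<close> outside the parts: the form in which the
  uniform distribution on the set is the product \<open>Pi_pmf\<close> of the uniform distributions
  on the parts.\<close>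

definition subset_choices :: "('a \<Rightarrow> 'b) \<Rightarrow> 'a set \<Rightarrow> nat \<Rightarrow> ('b \<Rightarrow> 'a set) set" where
  "subset_choices cls K m = PiE_dflt (cls ` K) {} (\<lambda>i. {S. S \<subseteq> {v\<in>K. cls v = i} \<and> card S = m})"

lemma subset_choices_finite_nonempty:
  assumes "finite K" "\<And>i. i \<in> cls ` K \<Longrightarrow> m \<le> card {v\<in>K. cls v = i}"
  shows "finite (subset_choices cls K m)" "subset_choices cls K m \<noteq> {}"
proof -
  have "\<exists>S. S \<subseteq> {v\<in>K. cls v = i} \<and> card S = m" if "i \<in> cls ` K" for i
    using obtain_subset_with_card_n[OF assms(2)[OF that]] by metis
  then show "subset_choices cls K m \<noteq> {}" by (auto simp: subset_choices_def)
  show "finite (subset_choices cls K m)"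
    unfolding subset_choices_def using assms(1) by (intro finite_PiE_dflt) auto
qed

lemma subset_choices_binomial:
  assumes fin: "finite K" and n: "\<And>i. i \<in> cls ` K \<Longrightarrow> card {v\<in>K. cls v = i} = n"
    and m: "0 < m" "m \<le> n" and A: "A \<subseteq> K" "inj_on cls A"
  shows "map_pmf (\<lambda>q. card (A \<inter> \<Union>(q ` cls ` K))) (pmf_of_set (subset_choices cls K m))
    = binomial_pmf (card A) (real m / real n)"
proof -
  define M where "M i = {S. S \<subseteq> {v\<in>K. cls v = i} \<and> card S = m}" for i
  have choices: "subset_choices cls K m = PiE_dflt (cls ` K) {} M"
    unfolding subset_choices_def M_def ..
  have ne: "M i \<noteq> {}" if "i \<in> cls ` K" for i
    using obtain_subset_with_card_n[of m "{v\<in>K. cls v = i}"] n[OF that] m(2) unfolding M_def by blast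
  have finM: "finite (M i)" for i using fin by (simp add: M_def)
  have eqPi: "Pi_pmf (cls ` K) {} (\<lambda>i. pmf_of_set (M i)) = pmf_of_set (subset_choices cls K m)"
    unfolding choices using fin finM ne by (intro Pi_pmf_of_set) auto
  have "binomial_pmf (card A) (real m / real n)
      = map_pmf (\<lambda>f. card {i\<in>cls ` A. f i}) (Pi_pmf (cls ` A) False (\<lambda>_. bernoulli_pmf (real m / real n)))"
    using fin A m by (intro binomial_pmf_altdef') (auto simp: card_image intro: finite_subset)
  also have "Pi_pmf (cls ` A) False (\<lambda>_. bernoulli_pmf (real m / real n))
      = Pi_pmf (cls ` A) False (\<lambda>i. map_pmf (\<lambda>S. S \<inter> A \<noteq> {}) (pmf_of_set (M i)))"
  proof (rule Pi_pmf_cong[OF refl refl])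
    fix i assume "i \<in> cls ` A"
    then obtain a where a: "a \<in> A" "i = cls a" by blast
    have "{v\<in>K. cls v = i} \<inter> A = {a}"
      using a A unfolding inj_on_def by blast
    moreover have "card {v\<in>K. cls v = i} = n" using a A by (intro n) blast
    ultimately show "bernoulli_pmf (real m / real n) = map_pmf (\<lambda>S. S \<inter> A \<noteq> {}) (pmf_of_set (M i))"
      unfolding M_def using uniform_subset_bernoulli[of "{v\<in>K. cls v = i}" m A a] fin m by simp
  qed
  also have "\<dots> = map_pmf (\<lambda>q. (\<lambda>S. S \<inter> A \<noteq> {}) \<circ> q) (Pi_pmf (cls ` A) {} (\<lambda>i. pmf_of_set (M i)))"
    using fin A by (intro Pi_pmf_map) (auto intro: finite_subset)
  \<comment> \<open>The choices in the parts that meet \<open>A\<close> are a marginal of the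
    choices in all parts.\<close>
  also have "Pi_pmf (cls ` A) {} (\<lambda>i. pmf_of_set (M i))
      = map_pmf (\<lambda>q i. if i \<in> cls ` A then q i else {}) (pmf_of_set (subset_choices cls K m))"
    unfolding eqPi[symmetric] using fin A by (intro Pi_pmf_subset) auto
  finally have "binomial_pmf (card A) (real m / real n)
      = map_pmf (\<lambda>q. card {i\<in>cls ` A. (if i \<in> cls ` A then q i else {}) \<inter> A \<noteq> {}})
          (pmf_of_set (subset_choices cls K m))"
    by (simp add: pmf.map_comp comp_def)
  also have "\<dots> = map_pmf (\<lambda>q. card (A \<inter> \<Union>(q ` cls ` K))) (pmf_of_set (subset_choices cls K m))"
  proof (rule map_pmf_cong[OF refl])
    fix q assume "q \<in> set_pmf (pmf_of_set (subset_choices cls K m))"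
    then have q: "q \<in> subset_choices cls K m"
      using subset_choices_finite_nonempty[OF fin, of cls m] n m by simp
    have qi: "q i \<subseteq> {v\<in>K. cls v = i}" if "i \<in> cls ` K" for i
      using q that unfolding subset_choices_def PiE_dflt_def by blast
    have "{i\<in>cls ` A. (if i \<in> cls ` A then q i else {}) \<inter> A \<noteq> {}} = cls ` (A \<inter> \<Union>(q ` cls ` K))"
    proof (intro equalityI subsetI)
      fix i assume "i \<in> {i\<in>cls ` A. (if i \<in> cls ` A then q i else {}) \<inter> A \<noteq> {}}"
      then have iA: "i \<in> cls ` A" and "q i \<inter> A \<noteq> {}" by auto
      then obtain a where a: "a \<in> q i" "a \<in> A" by blast
      have iK: "i \<in> cls ` K" using iA A by blast
      have "i = cls a" using subsetD[OF qi[OF iK] a(1)] by simp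
      moreover have "a \<in> A \<inter> \<Union>(q ` cls ` K)" using a iK by blast
      ultimately show "i \<in> cls ` (A \<inter> \<Union>(q ` cls ` K))" by (rule image_eqI)
    next
      fix i assume "i \<in> cls ` (A \<inter> \<Union>(q ` cls ` K))"
      then obtain a j where a: "a \<in> A" "i = cls a" "j \<in> cls ` K" "a \<in> q j" by blast
      have "cls a = j" using subsetD[OF qi[OF a(3)] a(4)] by simp
      then show "i \<in> {i\<in>cls ` A. (if i \<in> cls ` A then q i else {}) \<inter> A \<noteq> {}}" using a by auto
    qed
    moreover have "inj_on cls (A \<inter> \<Union>(q ` cls ` K))" using A(2) by (rule inj_on_subset) blast
    ultimately show "card {i\<in>cls ` A. (if i \<in> cls ` A then q i else {}) \<inter> A \<noteq> {}}
        = card (A \<inter> \<Union>(q ` cls ` K))" by (simp add: card_image)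
  qed
  finally show ?thesis ..
qed

text \<open>The number of \<open>i < m\<close> with \<open>N \<le> i\<close> is the positive part of
  \<open>m - N\<close>, which is what truncated subtraction of naturals computes.\<close>

lemma sum_binomial_tail:
  assumes fin: "finite K" and n: "\<And>i. i \<in> cls ` K \<Longrightarrow> card {v\<in>K. cls v = i} = n"
    and m: "0 < m" "m \<le> n" and A: "A \<subseteq> K" "inj_on cls A"
  shows "(\<Sum>i<m. measure_pmf.prob (binomial_pmf (card A) (real m / real n)) {..i})
    = (\<Sum>q\<in>subset_choices cls K m. real (m - card (A \<inter> \<Union>(q ` cls ` K))))
      / real (card (subset_choices cls K m))"
proof -
  let ?C = "subset_choices cls K m" and ?N = "\<lambda>q. card (A \<inter> \<Union>(q ` cls ` K))"
  have C: "finite ?C" "?C \<noteq> {}"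
    using subset_choices_finite_nonempty[OF fin, of cls m] n m by simp_all
  have "measure_pmf.prob (binomial_pmf (card A) (real m / real n)) {..i}
      = (\<Sum>q\<in>?C. of_bool (?N q \<le> i)) / real (card ?C)" for i
  proof -
    have "measure_pmf.prob (binomial_pmf (card A) (real m / real n)) {..i}
        = measure_pmf.prob (map_pmf ?N (pmf_of_set ?C)) {..i}"
      by (simp only: subset_choices_binomial[OF assms])
    also have "\<dots> = measure_pmf.prob (pmf_of_set ?C) (?N -` {..i})"
      by (rule measure_map_pmf)
    also have "\<dots> = real (card (?C \<inter> ?N -` {..i})) / real (card ?C)"
      by (rule measure_pmf_of_set[OF C(2,1)])
    also have "card (?C \<inter> ?N -` {..i}) = (\<Sum>q\<in>?C. of_bool (?N q \<le> i))"
      using C(1) by (subst sum_of_bool_eq) (auto intro!: arg_cong[of _ _ card])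
    finally show ?thesis by simp
  qed
  then have "(\<Sum>i<m. measure_pmf.prob (binomial_pmf (card A) (real m / real n)) {..i})
      = (\<Sum>q\<in>?C. \<Sum>i<m. of_bool (?N q \<le> i)) / real (card ?C)"
    by (simp add: sum.swap[of _ ?C] flip: sum_divide_distrib)
  moreover have "(\<Sum>i<m. of_bool (j \<le> i)) = real (m - j)" for j
  proof -
    have "{..<m} \<inter> {i. j \<le> i} = {j..<m}" by auto
    then show ?thesis by (simp add: sum_of_bool_eq)
  qed
  ultimately show ?thesis by simp
qed

context partitioned_graph
begin

text \<open>
  Inside a random choice of \<open>2k\<close> vertices per part every vertex is hit with probability \<open>1/(2k)\<close>,
  so a union bound over the chosen part of \<open>A\<close> applies. The chosen subsets are independent,
  which is where the binomial distribution comes from.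
\<close>

lemma transversal_distribution:
  assumes fin: "finite K" and deg: "\<And>u. u \<in> K \<Longrightarrow> card {v\<in>K. adj u v} \<le> k"
    and n: "\<And>i. i \<in> cls ` K \<Longrightarrow> card {v\<in>K. cls v = i} = n" and k: "0 < k" "2 * k \<le> n"
  shows "\<exists>\<tau>. (\<forall>T\<in>Collect (indep_transversal cls adj K). 0 \<le> \<tau> T) \<and>
      (\<Sum>T\<in>Collect (indep_transversal cls adj K). \<tau> T) = (1 :: rat) \<and>
      (\<forall>A. A \<subseteq> K \<longrightarrow> inj_on cls A \<longrightarrow>
        (\<Sum>i<2 * k. measure_pmf.prob (binomial_pmf (card A) (2 * real k / real n)) {..i}) / (2 * real k)
        \<le> real_of_rat (\<Sum>T\<in>{T\<in>Collect (indep_transversal cls adj K). T \<inter> A = {}}. \<tau> T))"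
proof -
  let ?F = "\<lambda>Q. Collect (indep_transversal cls adj Q)"
  let ?C = "subset_choices cls K (2 * k)"
  define U where "U q = \<Union>(q ` cls ` K)" for q :: "'b \<Rightarrow> 'a set"
  have C: "finite ?C" "?C \<noteq> {}"
    using subset_choices_finite_nonempty[OF fin, of cls "2 * k"] n k by simp_all
  have finF: "finite (?F K)"
    by (rule finite_subset[of _ "Pow K"]) (use fin in \<open>auto simp: indep_transversal_def\<close>)
  have fibre: "{v\<in>U q. cls v = i} = q i" and cardq: "card (q i) = 2 * k"
    if "q \<in> ?C" "i \<in> cls ` K" for q i
  proof -
    have sub: "q j \<subseteq> {v\<in>K. cls v = j} \<and> card (q j) = 2 * k" if "j \<in> cls ` K" for j
      using \<open>q \<in> ?C\<close> that unfolding subset_choices_def PiE_dflt_def by blast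
    show "{v\<in>U q. cls v = i} = q i"
    proof
      show "{v\<in>U q. cls v = i} \<subseteq> q i"
      proof
        fix v assume "v \<in> {v\<in>U q. cls v = i}"
        then obtain j where j: "j \<in> cls ` K" "v \<in> q j" and "cls v = i" unfolding U_def by blast
        moreover have "cls v = j" using sub[OF j(1)] j(2) by blast
        ultimately show "v \<in> q i" by simp
      qed
      show "q i \<subseteq> {v\<in>U q. cls v = i}"
        using sub[OF that(2)] that(2) unfolding U_def by auto
    qed
    show "card (q i) = 2 * k" using sub[OF that(2)] by blast
  qed
  have UK: "U q \<subseteq> K" if "q \<in> ?C" for q
    using that unfolding U_def subset_choices_def PiE_dflt_def by blast
  have clsU: "cls ` U q = cls ` K" if q: "q \<in> ?C" for q
  proof
    show "cls ` U q \<subseteq> cls ` K" using UK[OF q] by blast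
    show "cls ` K \<subseteq> cls ` U q"
    proof
      fix i assume i: "i \<in> cls ` K"
      have "q i \<noteq> {}" using cardq[OF q i] k by auto
      then obtain v where "v \<in> {v\<in>U q. cls v = i}" using fibre[OF q i] by auto
      then show "i \<in> cls ` U q" by auto
    qed
  qed
  \<comment> \<open>Every part keeps some vertices in \<open>U q\<close>, so a transversal of the
    chosen vertices is one of all of \<open>K\<close>.\<close>
  have FK: "?F (U q) \<subseteq> ?F K" if "q \<in> ?C" for q
  proof
    fix M assume "M \<in> ?F (U q)"
    then have "M \<subseteq> U q" "inj_on cls M" "cls ` M = cls ` K" "\<forall>u\<in>M. \<forall>v\<in>M. \<not> adj u v"
      unfolding indep_transversal_def mem_Collect_eq clsU[OF that] by simp_all
    then show "M \<in> ?F K"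
      using UK[OF that] unfolding indep_transversal_def mem_Collect_eq by (meson subset_trans)
  qed
  have "\<forall>q\<in>?C. \<exists>l. (\<forall>M\<in>?F (U q). 0 \<le> l M) \<and> (\<Sum>M\<in>?F (U q). l M) = (1 :: rat) \<and>
      (\<forall>v\<in>U q. (\<Sum>M\<in>{M\<in>?F (U q). v \<in> M}. l M) = 1 / (2 * of_nat k))"
  proof
    fix q assume q: "q \<in> ?C"
    have "finite (U q)" using UK[OF q] fin by (rule finite_subset)
    then show "\<exists>l. (\<forall>M\<in>?F (U q). 0 \<le> l M) \<and> (\<Sum>M\<in>?F (U q). l M) = (1 :: rat) \<and>
      (\<forall>v\<in>U q. (\<Sum>M\<in>{M\<in>?F (U q). v \<in> M}. l M) = 1 / (2 * of_nat k))"
    proof (rule fractional_transversal[OF _ _ _ k(1)])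
      fix u assume "u \<in> U q"
      then have "card {v\<in>K. adj u v} \<le> k" using UK[OF q] deg by blast
      moreover have "card {v\<in>U q. adj u v} \<le> card {v\<in>K. adj u v}"
        using UK[OF q] fin by (intro card_mono) auto
      ultimately show "card {v\<in>U q. adj u v} \<le> k" by simp
    next
      fix i assume "i \<in> cls ` U q"
      then show "card {v\<in>U q. cls v = i} = 2 * k"
        unfolding clsU[OF q] using fibre[OF q] cardq[OF q] by simp
    qed
  qed
  from bchoice[OF this] obtain l where "\<forall>q\<in>?C. (\<forall>M\<in>?F (U q). 0 \<le> l q M) \<and>
      (\<Sum>M\<in>?F (U q). l q M) = (1 :: rat) \<and>
      (\<forall>v\<in>U q. (\<Sum>M\<in>{M\<in>?F (U q). v \<in> M}. l q M) = 1 / (2 * of_nat k))" ..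
  then have l0: "\<And>q M. q \<in> ?C \<Longrightarrow> M \<in> ?F (U q) \<Longrightarrow> 0 \<le> l q M"
    and l1: "\<And>q. q \<in> ?C \<Longrightarrow> (\<Sum>M\<in>?F (U q). l q M) = 1"
    and lv: "\<And>q v. q \<in> ?C \<Longrightarrow> v \<in> U q \<Longrightarrow> (\<Sum>M\<in>{M\<in>?F (U q). v \<in> M}. l q M) = 1 / (2 * of_nat k)"
    by blast+
  \<comment> \<open>The mixture of the distributions \<open>l q\<close> over a uniform choice
    \<open>q\<close>, each extended by 0.\<close>
  define \<tau> where "\<tau> T = (\<Sum>q\<in>?C. if T \<in> ?F (U q) then l q T else 0) / of_nat (card ?C)" for T
  have cardC: "0 < card ?C" using C by (simp add: card_gt_0_iff)
  have sum_\<tau>: "(\<Sum>T\<in>{T\<in>?F K. P T}. \<tau> T) = (\<Sum>q\<in>?C. \<Sum>T\<in>{T\<in>?F (U q). P T}. l q T) / of_nat (card ?C)" for P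
  proof -
    have "(\<Sum>T\<in>{T\<in>?F K. P T}. \<tau> T)
        = (\<Sum>q\<in>?C. \<Sum>T\<in>{T\<in>?F K. P T}. if T \<in> ?F (U q) then l q T else 0) / of_nat (card ?C)"
      unfolding \<tau>_def by (subst sum.swap) (simp add: sum_divide_distrib)
    also have "(\<Sum>q\<in>?C. \<Sum>T\<in>{T\<in>?F K. P T}. if T \<in> ?F (U q) then l q T else 0)
        = (\<Sum>q\<in>?C. \<Sum>T\<in>{T\<in>?F (U q). P T}. l q T)"
    proof (rule sum.cong[OF refl])
      fix q assume q: "q \<in> ?C"
      show "(\<Sum>T\<in>{T\<in>?F K. P T}. if T \<in> ?F (U q) then l q T else 0) = (\<Sum>T\<in>{T\<in>?F (U q). P T}. l q T)"
        using FK[OF q] finF by (intro sum.mono_neutral_cong_right) auto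
    qed
    finally show ?thesis .
  qed
  have "real_of_rat (\<Sum>T\<in>{T\<in>?F K. T \<inter> A = {}}. \<tau> T)
      \<ge> (\<Sum>i<2 * k. measure_pmf.prob (binomial_pmf (card A) (2 * real k / real n)) {..i}) / (2 * real k)"
    if A: "A \<subseteq> K" "inj_on cls A" for A
  proof -
    \<comment> \<open>The union bound over \<open>A \<inter> U q\<close>, whose vertices are hit
      with probability \<open>1 / (2 * k)\<close> each. If there are more than \<open>2 * k\<close>
      of them, truncated subtraction leaves the trivial bound 0.\<close>
    have bound: "of_nat (2 * k - card (A \<inter> U q)) / (2 * of_nat k) \<le> (\<Sum>T\<in>{T\<in>?F (U q). T \<inter> A = {}}. l q T)"
      if q: "q \<in> ?C" for q
    proof -
      have finq: "finite (?F (U q))" using FK[OF q] finF by (rule finite_subset)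
      have finA: "finite (A \<inter> U q)" using A(1) fin by (meson finite_Int finite_subset)
      have "1 = (\<Sum>T\<in>{T\<in>?F (U q). T \<inter> A = {}}. l q T) + (\<Sum>T\<in>{T\<in>?F (U q). T \<inter> A \<noteq> {}}. l q T)"
        unfolding l1[OF q, symmetric] using finq
        by (subst sum.union_disjoint[symmetric]) (auto intro!: sum.cong)
      moreover have "(\<Sum>T\<in>{T\<in>?F (U q). T \<inter> A \<noteq> {}}. l q T) \<le> of_nat (card (A \<inter> U q)) / (2 * of_nat k)"
      proof -
        have "(\<Sum>T\<in>{T\<in>?F (U q). T \<inter> A \<noteq> {}}. l q T)
            \<le> (\<Sum>T\<in>?F (U q). \<Sum>a\<in>{a\<in>A \<inter> U q. a \<in> T}. l q T)"
        proof (rule sum_le_included[where i = id])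
          show "\<forall>T\<in>{T\<in>?F (U q). T \<inter> A \<noteq> {}}. \<exists>T'\<in>?F (U q). id T' = T \<and>
              l q T \<le> (\<Sum>a\<in>{a\<in>A \<inter> U q. a \<in> T'}. l q T')"
          proof
            fix T assume T: "T \<in> {T\<in>?F (U q). T \<inter> A \<noteq> {}}"
            then obtain a where "a \<in> A" "a \<in> T" by blast
            moreover have "T \<subseteq> U q" using T by (simp add: indep_transversal_def)
            ultimately have "{a\<in>A \<inter> U q. a \<in> T} \<noteq> {}" by blast
            moreover have "finite {a\<in>A \<inter> U q. a \<in> T}"
              using finA by (rule rev_finite_subset) blast
            ultimately have "1 \<le> card {a\<in>A \<inter> U q. a \<in> T}"
              unfolding Suc_le_eq One_nat_def card_gt_0_iff by blast
            then have "1 \<le> (of_nat (card {a\<in>A \<inter> U q. a \<in> T}) :: rat)" by simp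
            then have "l q T \<le> of_nat (card {a\<in>A \<inter> U q. a \<in> T}) * l q T"
              using l0[OF q, of T] T by (simp add: mult_le_cancel_right1)
            then show "\<exists>T'\<in>?F (U q). id T' = T \<and> l q T \<le> (\<Sum>a\<in>{a\<in>A \<inter> U q. a \<in> T'}. l q T')"
              using T by (intro bexI[of _ T]) auto
          qed
        qed (use finq l0[OF q] in \<open>auto intro!: sum_nonneg\<close>)
        also have "\<dots> = (\<Sum>a\<in>A \<inter> U q. \<Sum>T\<in>{T\<in>?F (U q). a \<in> T}. l q T)"
          using finq finA by (rule sum.swap_restrict)
        also have "\<dots> = of_nat (card (A \<inter> U q)) / (2 * of_nat k)" using lv[OF q] by simp
        finally show ?thesis .
      qed
      moreover have "0 \<le> (\<Sum>T\<in>{T\<in>?F (U q). T \<inter> A = {}}. l q T)"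
        using l0[OF q] by (intro sum_nonneg) auto
      moreover have "of_nat (2 * k - card (A \<inter> U q)) / (2 * of_nat k) =
          (if card (A \<inter> U q) \<le> 2 * k then 1 - of_nat (card (A \<inter> U q)) / (2 * of_nat k) else 0 :: rat)"
        using k by (simp add: of_nat_diff field_simps)
      ultimately show ?thesis by auto
    qed
    have "(\<Sum>q\<in>?C. of_nat (2 * k - card (A \<inter> U q)) / (2 * of_nat k)) / of_nat (card ?C)
        \<le> (\<Sum>T\<in>{T\<in>?F K. T \<inter> A = {}}. \<tau> T)"
      unfolding sum_\<tau> using bound by (intro divide_right_mono sum_mono) auto
    then have "real_of_rat ((\<Sum>q\<in>?C. of_nat (2 * k - card (A \<inter> U q)) / (2 * of_nat k)) / of_nat (card ?C))
        \<le> real_of_rat (\<Sum>T\<in>{T\<in>?F K. T \<inter> A = {}}. \<tau> T)"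
      by (simp only: of_rat_less_eq)
    moreover have "real_of_rat ((\<Sum>q\<in>?C. of_nat (2 * k - card (A \<inter> U q)) / (2 * of_nat k)) / of_nat (card ?C))
        = (\<Sum>q\<in>?C. real (2 * k - card (A \<inter> U q))) / real (card ?C) / (2 * real k)"
      by (simp add: of_rat_divide of_rat_sum of_rat_mult flip: sum_divide_distrib)
    moreover have "(\<Sum>i<2 * k. measure_pmf.prob (binomial_pmf (card A) (real (2 * k) / real n)) {..i})
        = (\<Sum>q\<in>?C. real (2 * k - card (A \<inter> U q))) / real (card ?C)"
      unfolding U_def using k by (intro sum_binomial_tail[OF fin n _ _ A]) auto
    ultimately show ?thesis by simp
  qed
  moreover have "\<forall>T\<in>?F K. 0 \<le> \<tau> T"
    unfolding \<tau>_def using l0 by (auto intro!: divide_nonneg_nonneg sum_nonneg)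
  moreover have "(\<Sum>T\<in>?F K. \<tau> T) = 1"
    using sum_\<tau>[of "\<lambda>_. True"] l1 cardC by simp
  ultimately show ?thesis by blast
qed

end

section \<open>The numerical bounds\<close>

definition p_numerator :: "nat \<Rightarrow> nat \<Rightarrow> real" where
  "p_numerator \<Delta> d = (\<Sum>i = 0..3. 1 / 4 * measure_pmf.prob (binomial_pmf d (4 / (real \<Delta> - 1))) {..i})"

lemma p_bound_eq: "p_bound \<Delta> d = p_numerator \<Delta> d / (real \<Delta> - real d + 1)"
  by (simp add: p_bound_def p_numerator_def)

lemma p_numerator_nonneg: "0 \<le> p_numerator \<Delta> d"
  unfolding p_numerator_def by (intro sum_nonneg) simp

lemma p_bound_nonneg: "d \<le> \<Delta> \<Longrightarrow> 0 \<le> p_bound \<Delta> d"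
  unfolding p_bound_eq by (intro divide_nonneg_nonneg p_numerator_nonneg) simp

lemma p_bound_0:
  assumes "6 \<le> \<Delta>"
  shows "p_bound \<Delta> 0 = 1 / (real \<Delta> + 1)"
proof -
  have "4 / (real \<Delta> - 1) \<in> {0..1}" using assms by simp
  then show ?thesis by (simp add: p_bound_def binomial_pmf_0)
qed

text \<open>Turns the avoidance bound for one vertex into the statement that it is hit with
  probability at most \<open>1 / \<omega>\<close>.\<close>

lemma p_numerator_1:
  assumes "6 \<le> \<Delta>"
  shows "p_numerator \<Delta> 1 = 1 - 1 / (real \<Delta> - 1)"
proof -
  define p where "p = 4 / (real \<Delta> - 1)"
  have p: "0 \<le> p" "p \<le> 1" using assms by (auto simp: p_def)
  have "measure_pmf.prob (binomial_pmf 1 p) {..i} = (if i = 0 then 1 - p else 1)" for i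
  proof -
    have "measure_pmf.prob (binomial_pmf 1 p) {..i} = (\<Sum>j\<le>i. pmf (binomial_pmf 1 p) j)"
      by (simp add: measure_measure_pmf_finite)
    also have "\<dots> = (\<Sum>j\<in>{..i} \<inter> {0, 1}. pmf (binomial_pmf 1 p) j)"
      using p by (intro sum.mono_neutral_right) (auto simp: pmf_binomial binomial_eq_0_iff)
    also have "{..i} \<inter> {0, 1} = (if i = 0 then {0} else {0, 1})" by auto
    finally show ?thesis using p by (simp add: pmf_binomial split: if_splits)
  qed
  then have "p_numerator \<Delta> 1 = (\<Sum>i\<in>{0, 1, 2, 3 :: nat}. 1 / 4 * (if i = 0 then 1 - p else 1))"
    unfolding p_numerator_def p_def[symmetric] by (intro sum.cong) auto
  also have "\<dots> = 1 - p / 4" by (simp add: field_simps)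
  also have "p / 4 = 1 / (real \<Delta> - 1)" using assms by (simp add: p_def field_simps)
  finally show ?thesis .
qed

lemma mu_upto_le: "d \<le> k \<Longrightarrow> mu_upto k \<Delta> \<le> p_bound \<Delta> d"
  unfolding mu_upto_def by (intro Min_le) auto

lemma mu_upto_nonneg: "k \<le> \<Delta> \<Longrightarrow> 0 \<le> mu_upto k \<Delta>"
  unfolding mu_upto_def by (subst Min_ge_iff) (auto intro: p_bound_nonneg)

lemma mu_upto_le_inverse: "6 \<le> \<Delta> \<Longrightarrow> mu_upto k \<Delta> \<le> 1 / (real \<Delta> + 1)"
  using mu_upto_le[of 0 k \<Delta>] by (simp add: p_bound_0)

text \<open>For \<open>b < a\<close> the solutions form the half-line up to
  \<open>c / (a - b)\<close>, so the maximum is attained and everything below it is a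
  solution.\<close>

lemma le_Greatest_linear:
  fixes a b c y :: real
  assumes "b < a" "y \<le> (GREATEST y. a * y \<le> c + b * y)"
  shows "a * y \<le> c + b * y"
proof -
  have *: "a * z \<le> c + b * z \<longleftrightarrow> z \<le> c / (a - b)" for z
    using assms(1) by (simp add: pos_le_divide_eq algebra_simps)
  have "(GREATEST y. a * y \<le> c + b * y) = c / (a - b)"
    unfolding * by (intro Greatest_equality) auto
  then show ?thesis using assms(2) * by simp
qed

lemma le_ytilde_k:
  assumes \<Delta>: "6 \<le> \<Delta>" and k: "k \<le> \<Delta> - 2" and y: "y \<le> ytilde_k k \<Delta>"
  shows "(1 + mu \<Delta>) * y \<le> 1 / 2 * (real \<Delta> - 1 - real k)
    + (1 / 2 + 1 / 2 * real k * (if k \<le> 3 then mu \<Delta> else mu_upto (\<Delta> + 1 - k) \<Delta>)) * y"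
proof -
  have coeff: "1 / 2 + 1 / 2 * real k * mu_upto j \<Delta> < 1 + mu \<Delta>" for j
  proof -
    have "real k * mu_upto j \<Delta> \<le> real k * (1 / (real \<Delta> + 1))"
      using mu_upto_le_inverse[OF \<Delta>] by (intro mult_left_mono) auto
    also have "\<dots> < 1" using k \<Delta> by (simp add: field_simps)
    finally show ?thesis using mu_upto_nonneg[of \<Delta> \<Delta>] by (simp add: mu_def)
  qed
  show ?thesis
  proof (cases "k \<le> 3")
    case True
    then show ?thesis using y le_Greatest_linear[OF coeff[of \<Delta>, folded mu_def]] by (simp add: ytilde_k_def)
  next
    case False
    then show ?thesis using y le_Greatest_linear[OF coeff[of "\<Delta> + 1 - k"]] by (simp add: ytilde_k_def)
  qed
qed

lemma le_ytilde:
  assumes "6 \<le> \<Delta>" "y \<le> ytilde \<Delta>"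
  shows "\<And>k. 1 \<le> k \<Longrightarrow> k \<le> \<Delta> - 2 \<Longrightarrow> y \<le> ytilde_k k \<Delta>" and "y \<le> real \<Delta> - 1"
    and "y * (1 - 3 * mu \<Delta>) \<le> real \<Delta> - 4"
proof -
  have y: "y \<le> Min ((\<lambda>k. ytilde_k k \<Delta>) ` {1..\<Delta> - 2})" "y \<le> real \<Delta> - 1"
    "y \<le> (real \<Delta> - 1 - 3) / (1 - 3 * mu \<Delta>)"
    using assms(2) by (auto simp: ytilde_def)
  show "y \<le> real \<Delta> - 1" by fact
  show "y \<le> ytilde_k k \<Delta>" if "1 \<le> k" "k \<le> \<Delta> - 2" for k
  proof -
    have "Min ((\<lambda>k. ytilde_k k \<Delta>) ` {1..\<Delta> - 2}) \<le> ytilde_k k \<Delta>" using that by (intro Min_le) auto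
    then show ?thesis using y(1) by simp
  qed
  have "mu \<Delta> \<le> 1 / (real \<Delta> + 1)" unfolding mu_def by (rule mu_upto_le_inverse[OF assms(1)])
  also have "\<dots> < 1 / 3" using assms(1) by (simp add: field_simps)
  finally have "0 < 1 - 3 * mu \<Delta>" by simp
  then show "y * (1 - 3 * mu \<Delta>) \<le> real \<Delta> - 4" using y(3) by (simp add: pos_le_divide_eq)
qed

section \<open>Graphs with sparsely attached maximum cliques\<close>

locale sparse_clique_graph =
  fixes V :: "'a set" and E :: "'a set set" and \<Delta> :: nat
  assumes fin_graph: "fin_graph V E"
    and max_degree: "max_degree V E = \<Delta>" and Delta: "6 \<le> \<Delta>"
    and clique_number: "clique_number V E = \<Delta> - 1"
    and disjoint: "pairwise disjnt (omega_cliques V E)"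
    and one_nbr: "\<forall>C \<in> omega_cliques V E. \<forall>v \<in> V - C. card (nbhd V E v \<inter> C) \<le> 1"
begin

lemma finite_V: "finite V"
  using fin_graph by (simp add: fin_graph_def)

lemma edgeD: "{u, v} \<in> E \<Longrightarrow> u \<in> V \<and> v \<in> V \<and> u \<noteq> v"
  using fin_graph unfolding fin_graph_def by (metis doubleton_in_nsets_2 subsetD)

lemma edge_commute: "{u, v} \<in> E \<longleftrightarrow> {v, u} \<in> E"
  by (simp add: insert_commute)

lemma no_loop: "{v, v} \<notin> E"
  using edgeD by blast

lemma mem_nbhd: "x \<in> nbhd V E v \<longleftrightarrow> {v, x} \<in> E"
  using edgeD by (auto simp: nbhd_def)

lemma finite_nbhd: "finite (nbhd V E v)"
  using finite_V by (simp add: nbhd_def)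

lemma finite_closed_nbhd: "finite (closed_nbhd V E v)"
  using finite_nbhd by (simp add: closed_nbhd_def)

lemma degree_le: "v \<in> V \<Longrightarrow> card (nbhd V E v) \<le> \<Delta>"
  unfolding max_degree[symmetric] max_degree_def using finite_V by (intro Max_ge) auto

lemma finite_cliques: "finite (cliques V E)"
  by (rule finite_subset[of _ "Pow V"]) (use finite_V in \<open>auto simp: cliques_def\<close>)

lemma clique_finite: "C \<in> cliques V E \<Longrightarrow> finite C"
  using finite_V by (auto simp: cliques_def intro: finite_subset)

lemma clique_sub: "C \<in> cliques V E \<Longrightarrow> C \<subseteq> V"
  by (simp add: cliques_def)

lemma clique_edge: "C \<in> cliques V E \<Longrightarrow> u \<in> C \<Longrightarrow> v \<in> C \<Longrightarrow> u \<noteq> v \<Longrightarrow> {u, v} \<in> E"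
  by (simp add: cliques_def clique_def)

lemma card_clique_le: "C \<in> cliques V E \<Longrightarrow> card C \<le> \<Delta> - 1"
  unfolding clique_number[symmetric] clique_number_def using finite_cliques by (intro Max_ge) auto

lemma omega_clique: "C \<in> omega_cliques V E \<longleftrightarrow> C \<in> cliques V E \<and> card C = \<Delta> - 1"
  by (simp add: omega_cliques_def clique_number)

lemma V_nonempty: "V \<noteq> {}"
proof -
  have "{} \<in> cliques V E" by (simp add: cliques_def clique_def)
  then have "\<Delta> - 1 \<in> card ` cliques V E"
    unfolding clique_number[symmetric] clique_number_def using finite_cliques by (intro Max_in) auto
  then obtain C where "C \<in> cliques V E" "card C = \<Delta> - 1" by auto
  then show ?thesis using Delta clique_sub by fastforce
qed

section \<open>The \<open>\<omega>\<close>-cliques as parts and the edges between them\<close>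

definition K :: "'a set" where
  "K = \<Union>(omega_cliques V E)"

text \<open>Meaningful on \<open>K\<close> only, where disjointness makes the clique unique.\<close>

definition cls :: "'a \<Rightarrow> 'a set" where
  "cls v = (THE C. C \<in> omega_cliques V E \<and> v \<in> C)"

definition cross :: "'a \<Rightarrow> 'a \<Rightarrow> bool" where
  "cross u v \<longleftrightarrow> {u, v} \<in> E \<and> cls u \<noteq> cls v"

lemma K_sub: "K \<subseteq> V"
  using omega_clique clique_sub unfolding K_def by blast

lemma finite_K: "finite K"
  using K_sub finite_V finite_subset by blast

lemma omega_disjoint:
  "C \<in> omega_cliques V E \<Longrightarrow> D \<in> omega_cliques V E \<Longrightarrow> v \<in> C \<Longrightarrow> v \<in> D \<Longrightarrow> C = D"
  using disjoint unfolding pairwise_def disjnt_def by blast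

lemma cls_eq: "C \<in> omega_cliques V E \<Longrightarrow> v \<in> C \<Longrightarrow> cls v = C"
  unfolding cls_def using omega_disjoint by (intro the_equality) blast+

lemma cls_mem: "v \<in> K \<Longrightarrow> cls v \<in> omega_cliques V E \<and> v \<in> cls v"
  using cls_eq unfolding K_def by auto

lemma cls_image: "cls ` K = omega_cliques V E"
proof
  show "cls ` K \<subseteq> omega_cliques V E" using cls_mem by blast
  show "omega_cliques V E \<subseteq> cls ` K"
  proof
    fix C assume C: "C \<in> omega_cliques V E"
    then have "C \<noteq> {}" using Delta by (auto simp: omega_clique)
    then obtain v where "v \<in> C" by blast
    then show "C \<in> cls ` K" using C cls_eq unfolding K_def by blast
  qed
qed

lemma cls_fibre: "C \<in> omega_cliques V E \<Longrightarrow> {v\<in>K. cls v = C} = C"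
  using cls_mem cls_eq unfolding K_def by auto

sublocale partitioned_graph cls cross
  by standard (auto simp: cross_def edge_commute)

text \<open>Of the at most \<open>\<Delta>\<close> neighbours of \<open>v\<close>, the clique
  already contains \<open>\<Delta> - 2\<close>.\<close>

lemma card_outside:
  assumes C: "C \<in> omega_cliques V E" and v: "v \<in> C"
  shows "card (nbhd V E v - C) \<le> 2"
proof -
  have Ccl: "C \<in> cliques V E" "card C = \<Delta> - 1" using C by (auto simp: omega_clique)
  have "C - {v} \<subseteq> nbhd V E v \<inter> C"
  proof
    fix x assume "x \<in> C - {v}"
    then show "x \<in> nbhd V E v \<inter> C" using clique_edge[OF Ccl(1) v, of x] by (auto simp: mem_nbhd)
  qed
  then have "card (C - {v}) \<le> card (nbhd V E v \<inter> C)" using finite_nbhd by (intro card_mono) auto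
  moreover have "card (C - {v}) = \<Delta> - 2" using v Ccl clique_finite by simp
  moreover have "card (nbhd V E v) = card (nbhd V E v \<inter> C) + card (nbhd V E v - C)"
    using finite_nbhd by (metis Int_Diff_disjoint Int_Diff_Un card_Un_disjoint finite_Diff finite_Int)
  moreover have "card (nbhd V E v) \<le> \<Delta>" using degree_le v clique_sub[OF Ccl(1)] by blast
  ultimately show ?thesis using Delta by linarith
qed

lemma cross_degree:
  assumes "u \<in> K"
  shows "card {v\<in>K. cross u v} \<le> 2"
proof -
  note c = cls_mem[OF assms]
  have "{v\<in>K. cross u v} \<subseteq> nbhd V E u - cls u"
  proof
    fix v assume v: "v \<in> {v\<in>K. cross u v}"
    then have "v \<notin> cls u" using c cls_eq by (auto simp: cross_def)
    then show "v \<in> nbhd V E u - cls u" using v by (simp add: cross_def mem_nbhd)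
  qed
  then have "card {v\<in>K. cross u v} \<le> card (nbhd V E u - cls u)"
    using finite_nbhd by (intro card_mono) auto
  then show ?thesis using card_outside c by force
qed

lemma unique_nbr:
  assumes "C \<in> omega_cliques V E" "v \<in> V" "v \<notin> C" "{v, a} \<in> E" "{v, b} \<in> E" "a \<in> C" "b \<in> C"
  shows "a = b"
proof -
  have "card (nbhd V E v \<inter> C) \<le> Suc 0" using one_nbr assms by auto
  then show ?thesis using assms finite_nbhd by (auto simp: card_le_Suc0_iff_eq mem_nbhd)
qed

text \<open>Neighbours in \<open>K\<close> of an outside vertex lie in different cliques, hence are
  chosen independently.\<close>

lemma inj_cls_nbhd:
  assumes "v \<in> V - K"
  shows "inj_on cls (nbhd V E v \<inter> K)"
proof (rule inj_onI)
  fix a b assume a: "a \<in> nbhd V E v \<inter> K" and b: "b \<in> nbhd V E v \<inter> K" and eq: "cls a = cls b"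
  have "cls a \<in> omega_cliques V E" "a \<in> cls a" "b \<in> cls a" using a b eq cls_mem by auto
  moreover have "v \<notin> cls a" using \<open>cls a \<in> omega_cliques V E\<close> assms unfolding K_def by blast
  ultimately show "a = b"
    using a b assms by (intro unique_nbr[of "cls a" v]) (auto simp: mem_nbhd)
qed

lemma stable_sets_iff: "S \<in> stable_sets V E \<longleftrightarrow> S \<subseteq> V \<and> (\<forall>u\<in>S. \<forall>v\<in>S. {u, v} \<notin> E)"
  unfolding stable_sets_def indep_def mem_Collect_eq using edgeD by meson

lemma finite_stable_sets: "finite (stable_sets V E)"
  by (rule finite_subset[of _ "Pow V"]) (use finite_V in \<open>auto simp: stable_sets_def\<close>)

lemma maximal_stable_superset:
  assumes "S \<in> stable_sets V E"
  obtains M where "M \<in> stable_sets V E" "S \<subseteq> M" "\<And>v. v \<in> V \<Longrightarrow> closed_nbhd V E v \<inter> M \<noteq> {}"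
proof -
  obtain M where M: "M \<in> stable_sets V E" "S \<subseteq> M" "\<forall>N\<in>stable_sets V E. M \<subseteq> N \<longrightarrow> M = N"
    using finite_has_maximal2[OF finite_stable_sets assms] by blast
  have "closed_nbhd V E v \<inter> M \<noteq> {}" if v: "v \<in> V" for v
  proof
    assume "closed_nbhd V E v \<inter> M = {}"
    then have vM: "v \<notin> M" and free: "\<And>x. x \<in> M \<Longrightarrow> {v, x} \<notin> E"
      by (auto simp: closed_nbhd_def mem_nbhd)
    have free': "{x, v} \<notin> E" if "x \<in> M" for x using free[OF that] by (simp add: insert_commute)
    have "insert v M \<in> stable_sets V E"
      using M(1) v free free' no_loop unfolding stable_sets_iff by auto
    then show False using M(3) vM by blast
  qed
  then show thesis using that M by blast
qed

lemma transversal_stable: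
  assumes "indep_transversal cls cross K T"
  shows "T \<in> stable_sets V E"
  unfolding stable_sets_iff
proof (intro conjI ballI notI)
  show "T \<subseteq> V" using assms K_sub by (auto simp: indep_transversal_def)
  fix u v assume uv: "u \<in> T" "v \<in> T" "{u, v} \<in> E"
  then have "u \<noteq> v" using edgeD by blast
  then have "cls u \<noteq> cls v" using assms uv by (auto simp: indep_transversal_def dest: inj_onD)
  then show False using assms uv by (auto simp: indep_transversal_def cross_def)
qed

end

text \<open>The image of a distribution under \<open>g\<close>: the mass of an event is the mass of
  its preimage.\<close>

lemma sum_fibres:
  assumes "finite \<Omega>" "finite \<S>" "g ` \<Omega> \<subseteq> \<S>"
  shows "(\<Sum>S\<in>{S\<in>\<S>. Q S}. \<Sum>x\<in>{x\<in>\<Omega>. g x = S}. P x) = (\<Sum>x\<in>{x\<in>\<Omega>. Q (g x)}. P x)"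
proof -
  have "(\<Sum>S\<in>{S\<in>\<S>. Q S}. \<Sum>x\<in>{x\<in>\<Omega>. g x = S}. P x)
      = (\<Sum>S\<in>{S\<in>\<S>. Q S}. \<Sum>x\<in>{x\<in>{x\<in>\<Omega>. Q (g x)}. g x = S}. P x)"
    by (intro sum.cong refl) auto
  also have "\<dots> = (\<Sum>x\<in>{x\<in>\<Omega>. Q (g x)}. P x)"
    using assms by (intro sum.group) auto
  finally show ?thesis .
qed

section \<open>The random stable set\<close>

context sparse_clique_graph
begin

text \<open>The case \<open>k = 2\<close>, \<open>n = \<omega>\<close> of
  \<open>transversal_distribution\<close>. Avoiding \<open>{v}\<close> bounds the probability of
  \<open>v\<close> by \<open>1 / \<omega>\<close> from above; the \<open>\<omega>\<close>
  probabilities of a clique sum to 1, so these bounds are equalities.\<close>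

lemma clique_transversals:
  obtains \<tau> :: "'a set \<Rightarrow> rat" where
    "\<And>T. indep_transversal cls cross K T \<Longrightarrow> 0 \<le> \<tau> T"
    "(\<Sum>T\<in>Collect (indep_transversal cls cross K). \<tau> T) = 1"
    "\<And>v. v \<in> K \<Longrightarrow> (\<Sum>T\<in>{T\<in>Collect (indep_transversal cls cross K). v \<in> T}. \<tau> T) = 1 / (of_nat \<Delta> - 1)"
    "\<And>A. A \<subseteq> K \<Longrightarrow> inj_on cls A \<Longrightarrow> p_numerator \<Delta> (card A)
      \<le> real_of_rat (\<Sum>T\<in>{T\<in>Collect (indep_transversal cls cross K). T \<inter> A = {}}. \<tau> T)"
proof -
  let ?F = "Collect (indep_transversal cls cross K)"
  have finF: "finite ?F"
    by (rule finite_subset[of _ "Pow K"]) (use finite_K in \<open>auto simp: indep_transversal_def\<close>)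
  have "\<exists>\<tau>. (\<forall>T\<in>?F. 0 \<le> \<tau> T) \<and> (\<Sum>T\<in>?F. \<tau> T) = (1 :: rat) \<and>
      (\<forall>A. A \<subseteq> K \<longrightarrow> inj_on cls A \<longrightarrow>
        (\<Sum>i<2 * 2. measure_pmf.prob (binomial_pmf (card A) (2 * real 2 / real (\<Delta> - 1))) {..i}) / (2 * real 2)
        \<le> real_of_rat (\<Sum>T\<in>{T\<in>?F. T \<inter> A = {}}. \<tau> T))"
  proof (rule transversal_distribution[OF finite_K cross_degree])
    show "card {v\<in>K. cls v = C} = \<Delta> - 1" if "C \<in> cls ` K" for C
      using that cls_fibre[of C] by (simp add: cls_image omega_clique)
  qed (use Delta in auto)
  then obtain \<tau> where \<tau>0: "\<forall>T\<in>?F. 0 \<le> \<tau> T" and \<tau>1: "(\<Sum>T\<in>?F. \<tau> T) = (1 :: rat)"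
    and \<tau>A: "\<forall>A. A \<subseteq> K \<longrightarrow> inj_on cls A \<longrightarrow>
        (\<Sum>i<2 * 2. measure_pmf.prob (binomial_pmf (card A) (2 * real 2 / real (\<Delta> - 1))) {..i}) / (2 * real 2)
        \<le> real_of_rat (\<Sum>T\<in>{T\<in>?F. T \<inter> A = {}}. \<tau> T)" by blast
  have avoid: "p_numerator \<Delta> (card A) \<le> real_of_rat (\<Sum>T\<in>{T\<in>?F. T \<inter> A = {}}. \<tau> T)"
    if A: "A \<subseteq> K" "inj_on cls A" for A
  proof -
    have "{..<2 * 2} = {0..3 :: nat}" by auto
    moreover have "real (\<Delta> - 1) = real \<Delta> - 1" using Delta by simp
    ultimately have eq: "(\<Sum>i<2 * 2. measure_pmf.prob (binomial_pmf (card A) (2 * real 2 / real (\<Delta> - 1))) {..i}) / (2 * real 2)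
        = p_numerator \<Delta> (card A)"
      by (simp add: p_numerator_def flip: sum_divide_distrib)
    show ?thesis using \<tau>A[rule_format, OF A] unfolding eq .
  qed
  define P where "P v = (\<Sum>T\<in>{T\<in>?F. v \<in> T}. \<tau> T)" for v
  have P_le: "P v \<le> 1 / (of_nat \<Delta> - 1)" if v: "v \<in> K" for v
  proof -
    have "(\<Sum>T\<in>?F. \<tau> T) = P v + (\<Sum>T\<in>{T\<in>?F. T \<inter> {v} = {}}. \<tau> T)"
      unfolding P_def using finF by (subst sum.union_disjoint[symmetric]) (auto intro!: sum.cong)
    then have "real_of_rat (\<Sum>T\<in>{T\<in>?F. T \<inter> {v} = {}}. \<tau> T) = 1 - real_of_rat (P v)"
      by (simp add: \<tau>1 of_rat_diff eq_diff_eq flip: of_rat_add)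
    then have "p_numerator \<Delta> 1 \<le> 1 - real_of_rat (P v)" using avoid[of "{v}"] v by simp
    then have "real_of_rat (P v) \<le> real_of_rat (1 / (of_nat \<Delta> - 1))"
      by (simp only: p_numerator_1[OF Delta]) (simp add: of_rat_divide of_rat_diff)
    then show ?thesis by (simp only: of_rat_less_eq)
  qed
  have P_eq: "P v = 1 / (of_nat \<Delta> - 1)" if v: "v \<in> K" for v
  proof -
    define C where "C = cls v"
    have C: "C \<in> omega_cliques V E" "v \<in> C" using cls_mem[OF v] by (auto simp: C_def)
    have finC: "finite C" and cardC: "card C = \<Delta> - 1" using C(1) clique_finite by (auto simp: omega_clique)
    have CK: "C \<subseteq> K" using C(1) unfolding K_def by blast
    have "(\<Sum>u\<in>C. P u) = (\<Sum>T\<in>?F. \<Sum>u\<in>{u\<in>C. u \<in> T}. \<tau> T)"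
      unfolding P_def using finC finF by (rule sum.swap_restrict)
    also have "\<dots> = (\<Sum>T\<in>?F. \<tau> T)"
    proof (rule sum.cong[OF refl])
      fix T assume "T \<in> ?F"
      then have T: "T \<subseteq> K" "inj_on cls T" "cls ` T = cls ` K" by (auto simp: indep_transversal_def)
      have "C \<in> cls ` T" unfolding T(3) cls_image by (rule C(1))
      then obtain t where t: "t \<in> T" "C = cls t" by blast
      have "{u\<in>C. u \<in> T} = {t}"
      proof (intro equalityI subsetI)
        fix u assume u: "u \<in> {u\<in>C. u \<in> T}"
        then have "cls u = cls t" using cls_eq[OF C(1)] t(2) by simp
        then show "u \<in> {t}" using inj_onD[OF T(2)] u t(1) by blast
      next
        fix u assume "u \<in> {t}"
        moreover have "t \<in> cls t" using cls_mem t(1) T(1) by blast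
        ultimately show "u \<in> {u\<in>C. u \<in> T}" using t by simp
      qed
      then show "(\<Sum>u\<in>{u\<in>C. u \<in> T}. \<tau> T) = \<tau> T" by simp
    qed
    also have "\<dots> = (\<Sum>u\<in>C. 1 / (of_nat \<Delta> - 1))"
      using cardC Delta by (simp add: \<tau>1 of_nat_diff)
    finally have "(\<Sum>u\<in>C. P u) = (\<Sum>u\<in>C. 1 / (of_nat \<Delta> - 1))" .
    then show ?thesis using P_le CK C(2) finC sum_mono_inv[of P C "\<lambda>_. 1 / (of_nat \<Delta> - 1)" v] by blast
  qed
  show thesis
    by (rule that[of \<tau>]) (use \<tau>0 \<tau>1 P_eq avoid in \<open>auto simp: P_def\<close>)
qed

text \<open>
  The random stable set is a maximal extension of \<open>T \<union> (B - N(T))\<close> for independent \<open>T\<close> and \<open>B\<close>: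
  \<open>T\<close> a transversal of the \<open>\<omega>\<close>-cliques, \<open>B\<close> a stable set outside of them.
\<close>

lemma good_distribution:
  obtains f :: "'a set \<Rightarrow> rat" and pr :: "'a \<Rightarrow> rat" where
    "\<And>S. S \<in> stable_sets V E \<Longrightarrow> 0 \<le> f S" "(\<Sum>S\<in>stable_sets V E. f S) = 1"
    "\<And>v. pr v = (\<Sum>S\<in>{S\<in>stable_sets V E. v \<in> S}. f S)"
    "\<And>v. v \<in> V \<Longrightarrow> 1 \<le> (\<Sum>x\<in>closed_nbhd V E v. pr x)"
    "\<And>v. v \<in> K \<Longrightarrow> pr v = 1 / (of_nat \<Delta> - 1)"
    "\<And>v. v \<in> V - K \<Longrightarrow> p_bound \<Delta> (card (nbhd V E v \<inter> K)) \<le> real_of_rat (pr v)"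
proof -
  let ?F = "Collect (indep_transversal cls cross K)"
  obtain \<tau> :: "'a set \<Rightarrow> rat" where \<tau>0: "\<And>T. indep_transversal cls cross K T \<Longrightarrow> 0 \<le> \<tau> T"
    and \<tau>1: "(\<Sum>T\<in>?F. \<tau> T) = 1"
    and \<tau>v: "\<And>v. v \<in> K \<Longrightarrow> (\<Sum>T\<in>{T\<in>?F. v \<in> T}. \<tau> T) = 1 / (of_nat \<Delta> - 1)"
    and \<tau>A: "\<And>A. A \<subseteq> K \<Longrightarrow> inj_on cls A \<Longrightarrow> p_numerator \<Delta> (card A)
      \<le> real_of_rat (\<Sum>T\<in>{T\<in>?F. T \<inter> A = {}}. \<tau> T)"
    by (rule clique_transversals) (rule that; assumption)
  define G where "G = {B. B \<subseteq> V - K \<and> (\<forall>u\<in>B. \<forall>v\<in>B. {u, v} \<notin> E)}"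
  have "\<exists>\<beta>. (\<forall>B\<in>G. 0 \<le> \<beta> B) \<and> (\<Sum>B\<in>G. \<beta> B) = (1 :: rat) \<and>
      (\<forall>v\<in>V - K. 1 / (of_nat (card {u\<in>V - K. {v, u} \<in> E}) + 1) \<le> (\<Sum>B\<in>{B\<in>G. v \<in> B}. \<beta> B))"
    unfolding G_def using finite_V no_loop
    by (intro fractional_caro_wei) (auto simp: insert_commute)
  then obtain \<beta> where \<beta>0: "\<And>B. B \<in> G \<Longrightarrow> 0 \<le> \<beta> B" and \<beta>1: "(\<Sum>B\<in>G. \<beta> B) = (1 :: rat)"
    and \<beta>v: "\<And>v. v \<in> V - K \<Longrightarrow>
      1 / (of_nat (card {u\<in>V - K. {v, u} \<in> E}) + 1) \<le> (\<Sum>B\<in>{B\<in>G. v \<in> B}. \<beta> B)" by blast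
  have finF: "finite ?F"
    by (rule finite_subset[of _ "Pow K"]) (use finite_K in \<open>auto simp: indep_transversal_def\<close>)
  have finG: "finite G"
    by (rule finite_subset[of _ "Pow V"]) (use finite_V in \<open>auto simp: G_def\<close>)
  define core where "core = (\<lambda>(T, B). T \<union> {b\<in>B. \<forall>t\<in>T. {b, t} \<notin> E})"
  have "\<forall>x\<in>?F \<times> G. \<exists>M. M \<in> stable_sets V E \<and> core x \<subseteq> M \<and> (\<forall>v\<in>V. closed_nbhd V E v \<inter> M \<noteq> {})"
  proof
    fix x assume "x \<in> ?F \<times> G"
    then obtain T B where x: "x = (T, B)" "indep_transversal cls cross K T" "B \<in> G" by auto
    have T: "T \<subseteq> V" "\<forall>u\<in>T. \<forall>v\<in>T. {u, v} \<notin> E"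
      using transversal_stable[OF x(2)] by (auto simp: stable_sets_iff)
    have B: "B \<subseteq> V" "\<forall>u\<in>B. \<forall>v\<in>B. {u, v} \<notin> E" using x(3) by (auto simp: G_def)
    have "{u, v} \<notin> E" if "u \<in> core x" "v \<in> core x" for u v
      using that T(2) B(2) by (auto simp: core_def x(1) insert_commute)
    then have "core x \<in> stable_sets V E"
      using T(1) B(1) unfolding stable_sets_iff by (auto simp: core_def x(1))
    then obtain M where "M \<in> stable_sets V E" "core x \<subseteq> M" "\<And>v. v \<in> V \<Longrightarrow> closed_nbhd V E v \<inter> M \<noteq> {}"
      by (rule maximal_stable_superset) (rule that; assumption)
    then show "\<exists>M. M \<in> stable_sets V E \<and> core x \<subseteq> M \<and> (\<forall>v\<in>V. closed_nbhd V E v \<inter> M \<noteq> {})" by blast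
  qed
  from bchoice[OF this] obtain g where g: "\<forall>x\<in>?F \<times> G. g x \<in> stable_sets V E \<and> core x \<subseteq> g x \<and>
      (\<forall>v\<in>V. closed_nbhd V E v \<inter> g x \<noteq> {})" ..
  have gS: "g x \<in> stable_sets V E" if "x \<in> ?F \<times> G" for x
    using bspec[OF g that] by (rule conjunct1)
  have gcore: "core x \<subseteq> g x" if "x \<in> ?F \<times> G" for x
    using bspec[OF g that] by (elim conjE)
  have gmax: "closed_nbhd V E v \<inter> g x \<noteq> {}" if "x \<in> ?F \<times> G" "v \<in> V" for x v
    using bspec[OF g that(1)] that(2) by (elim conjE) (rule bspec)
  define P where "P = (\<lambda>(T, B). \<tau> T * \<beta> B)"
  have P0: "0 \<le> P x" if "x \<in> ?F \<times> G" for x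
    using that \<tau>0 \<beta>0 by (auto simp: P_def)
  have P_times: "(\<Sum>x\<in>A \<times> B. P x) = (\<Sum>T\<in>A. \<tau> T) * (\<Sum>B\<in>B. \<beta> B)" for A B
    by (simp add: P_def sum_product sum.cartesian_product)
  have fin\<Omega>: "finite (?F \<times> G)" using finF finG by simp
  define f where "f S = (\<Sum>x\<in>{x\<in>?F \<times> G. g x = S}. P x)" for S
  define pr where "pr v = (\<Sum>S\<in>{S\<in>stable_sets V E. v \<in> S}. f S)" for v
  have g_img: "g ` (?F \<times> G) \<subseteq> stable_sets V E" using gS by blast
  have pr: "pr v = (\<Sum>x\<in>{x\<in>?F \<times> G. v \<in> g x}. P x)" for v
    unfolding pr_def f_def by (rule sum_fibres[OF fin\<Omega> finite_stable_sets g_img])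
  have f0: "0 \<le> f S" for S unfolding f_def using P0 by (intro sum_nonneg) blast
  have f1: "(\<Sum>S\<in>stable_sets V E. f S) = 1"
    using sum_fibres[where Q = "\<lambda>_. True" and P = P, OF fin\<Omega> finite_stable_sets g_img]
    by (simp add: f_def P_times \<tau>1 \<beta>1)
  \<comment> \<open>The sum is the expected number of vertices of \<open>g x\<close> in the closed
    neighbourhood, and by maximality there is always at least one.\<close>
  have pr_nbhd: "1 \<le> (\<Sum>x\<in>closed_nbhd V E v. pr x)" if v: "v \<in> V" for v
  proof -
    have "(\<Sum>u\<in>closed_nbhd V E v. pr u)
        = (\<Sum>x\<in>?F \<times> G. \<Sum>u\<in>{u\<in>closed_nbhd V E v. u \<in> g x}. P x)"
      unfolding pr using finite_closed_nbhd fin\<Omega> by (rule sum.swap_restrict)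
    moreover have "(\<Sum>x\<in>?F \<times> G. P x) \<le> (\<Sum>x\<in>?F \<times> G. \<Sum>u\<in>{u\<in>closed_nbhd V E v. u \<in> g x}. P x)"
    proof (rule sum_mono)
      fix x assume x: "x \<in> ?F \<times> G"
      have "{u\<in>closed_nbhd V E v. u \<in> g x} \<noteq> {}" using gmax[OF x v] by blast
      moreover have "finite {u\<in>closed_nbhd V E v. u \<in> g x}" using finite_closed_nbhd by simp
      ultimately have "1 \<le> card {u\<in>closed_nbhd V E v. u \<in> g x}"
        unfolding Suc_le_eq One_nat_def card_gt_0_iff by blast
      then have "1 \<le> (of_nat (card {u\<in>closed_nbhd V E v. u \<in> g x}) :: rat)" by simp
      then have "1 * P x \<le> of_nat (card {u\<in>closed_nbhd V E v. u \<in> g x}) * P x"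
        using P0[OF x] by (rule mult_right_mono)
      then show "P x \<le> (\<Sum>u\<in>{u\<in>closed_nbhd V E v. u \<in> g x}. P x)" by simp
    qed
    ultimately show ?thesis by (simp add: P_times \<tau>1 \<beta>1)
  qed
  have pr_K: "pr v = 1 / (of_nat \<Delta> - 1)" if v: "v \<in> K" for v
  proof -
    \<comment> \<open>The extension cannot add a vertex of an \<open>\<omega>\<close>-clique,
      because \<open>T\<close> already has one in it.\<close>
    have "{x\<in>?F \<times> G. v \<in> g x} = {T\<in>?F. v \<in> T} \<times> G"
    proof (intro equalityI subsetI)
      fix x assume "x \<in> {T\<in>?F. v \<in> T} \<times> G"
      then obtain T B where x: "x = (T, B)" "x \<in> ?F \<times> G" "v \<in> T" by blast
      then have "v \<in> core x" by (simp add: core_def)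
      then show "x \<in> {x\<in>?F \<times> G. v \<in> g x}" using gcore x(2) by blast
    next
      fix x assume x: "x \<in> {x\<in>?F \<times> G. v \<in> g x}"
      then obtain T B where TB: "x = (T, B)" "T \<in> ?F" "B \<in> G" by blast
      have vg: "v \<in> g x" and xF: "x \<in> ?F \<times> G" using x by auto
      have "cls v \<in> cls ` T" using TB(2) v by (simp add: indep_transversal_def)
      then obtain t where t: "t \<in> T" "cls v = cls t" by blast
      have tK: "t \<in> K" using t TB(2) by (auto simp: indep_transversal_def)
      have tg: "t \<in> g x" using subsetD[OF gcore[OF xF]] t(1) TB(1) by (simp add: core_def)
      have "v = t"
      proof (rule ccontr)
        assume "v \<noteq> t"
        moreover have "cls v \<in> cliques V E" "v \<in> cls v" "t \<in> cls v"
          using cls_mem[OF v] cls_mem[OF tK] t(2) omega_clique by simp_all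
        ultimately have "{v, t} \<in> E" using clique_edge by blast
        then show False using gS[OF xF] vg tg by (auto simp: stable_sets_iff)
      qed
      then show "x \<in> {T\<in>?F. v \<in> T} \<times> G" using TB t(1) by simp
    qed
    then show ?thesis unfolding pr using \<tau>v[OF v] \<beta>1 by (simp only: P_times mult_1_right)
  qed
  have pr_out: "p_bound \<Delta> (card (nbhd V E v \<inter> K)) \<le> real_of_rat (pr v)" if v: "v \<in> V - K" for v
  proof -
    let ?A = "nbhd V E v \<inter> K" and ?O = "{u\<in>V - K. {v, u} \<in> E}"
    let ?t = "\<Sum>T\<in>{T\<in>?F. T \<inter> ?A = {}}. \<tau> T" and ?b = "\<Sum>B\<in>{B\<in>G. v \<in> B}. \<beta> B"
    have sub: "{T\<in>?F. T \<inter> ?A = {}} \<times> {B\<in>G. v \<in> B} \<subseteq> {x\<in>?F \<times> G. v \<in> g x}"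
    proof
      \<comment> \<open>If \<open>v \<in> B\<close> and \<open>T\<close> avoids its neighbours, then
        \<open>v\<close> survives in the core. This event is a rectangle, so its probability is a
        product.\<close>
      fix x assume "x \<in> {T\<in>?F. T \<inter> ?A = {}} \<times> {B\<in>G. v \<in> B}"
      then obtain T B where x: "x = (T, B)" "x \<in> ?F \<times> G" "T \<in> ?F" "T \<inter> ?A = {}" "v \<in> B" by blast
      have "T \<subseteq> K" using x(3) by (simp add: indep_transversal_def)
      then have "\<forall>t\<in>T. {v, t} \<notin> E" using x(4) by (auto simp: mem_nbhd)
      then have "v \<in> core x" using x(1,5) by (simp add: core_def)
      then show "x \<in> {x\<in>?F \<times> G. v \<in> g x}" using gcore x(2) by blast
    qed
    have "?t * ?b \<le> pr v"
      unfolding pr P_times[symmetric] using sub fin\<Omega> P0 by (intro sum_mono2) auto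
    then have "real_of_rat ?t * real_of_rat ?b \<le> real_of_rat (pr v)"
      by (simp only: of_rat_less_eq flip: of_rat_mult)
    moreover have "p_numerator \<Delta> (card ?A) \<le> real_of_rat ?t"
      using inj_cls_nbhd[OF v] by (intro \<tau>A) auto
    moreover have "1 / (real \<Delta> - real (card ?A) + 1) \<le> real_of_rat ?b"
    proof -
      have "nbhd V E v = ?A \<union> ?O" "?A \<inter> ?O = {}" by (auto simp: nbhd_def)
      then have "card (nbhd V E v) = card ?A + card ?O"
        using finite_nbhd by (metis card_Un_disjoint finite_Un)
      then have "real (card ?O) \<le> real \<Delta> - real (card ?A)" using degree_le[of v] v by simp
      then have "1 / (real \<Delta> - real (card ?A) + 1) \<le> 1 / (real (card ?O) + 1)"
        by (intro divide_left_mono) auto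
      also have "\<dots> = real_of_rat (1 / (of_nat (card ?O) + 1))"
        by (simp add: of_rat_divide of_rat_add)
      also have "\<dots> \<le> real_of_rat ?b" using \<beta>v[OF v] by (simp only: of_rat_less_eq)
      finally show ?thesis .
    qed
    moreover have "card ?A \<le> \<Delta>"
      using degree_le[of v] v card_mono[OF finite_nbhd, of ?A v] by simp
    moreover have "0 \<le> ?t" using \<tau>0 by (intro sum_nonneg) blast
    then have "0 \<le> real_of_rat ?t" by (simp only: zero_le_of_rat_iff)
    ultimately have "p_numerator \<Delta> (card ?A) * (1 / (real \<Delta> - real (card ?A) + 1))
        \<le> real_of_rat ?t * real_of_rat ?b"
      by (intro mult_mono) auto
    then show ?thesis using \<open>real_of_rat ?t * real_of_rat ?b \<le> real_of_rat (pr v)\<close>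
      by (simp add: p_bound_eq)
  qed
  show thesis
    by (rule that[of f pr]) (rule f0 f1 pr_def pr_nbhd pr_K pr_out; assumption?)+
qed

end

section \<open>Bounding \<open>\<rho>\<close> at each vertex\<close>

lemma of_rat_Max_le:
  assumes "finite A" "A \<noteq> {}" "\<And>x. x \<in> A \<Longrightarrow> real_of_rat (h x) \<le> b"
  shows "real_of_rat (Max (h ` A)) \<le> b"
proof -
  have "Max (h ` A) \<in> h ` A" using assms(1,2) by (intro Max_in) auto
  then show ?thesis using assms(3) by auto
qed

text \<open>Twice the inequality that defines \<open>ytilde_k\<close>, with \<open>z\<close> for
  \<open>k * m * Y\<close> and \<open>t\<close> for \<open>mu \<Delta> * Y\<close> so that
  everything is linear.\<close>

lemma clique_arith:
  fixes s k z y t d :: real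
  assumes "s \<le> k - z" "y + t \<le> 1 / 2 * (d - 1 - k) + (1 / 2 * y + 1 / 2 * z)"
  shows "s \<le> d - 1 - y - 2 * t"
  using assms by (simp add: field_simps)

context sparse_clique_graph
begin

lemma of_rat_wclique_le:
  assumes "v \<in> V" "\<And>C. C \<in> cliques V E \<Longrightarrow> v \<in> C \<Longrightarrow> (\<Sum>x\<in>C. real_of_rat (u x)) \<le> b"
  shows "real_of_rat (wclique V E u v) \<le> b"
  unfolding wclique_def
proof (rule of_rat_Max_le)
  have "{v} \<in> cliques V E" using assms(1) by (simp add: cliques_def clique_def)
  then show "{C \<in> cliques V E. v \<in> C} \<noteq> {}" by blast
qed (use finite_cliques assms(2) in \<open>auto simp: of_rat_sum\<close>)

text \<open>A vertex of \<open>D\<close> outside \<open>C\<close> has at most one neighbour in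
  \<open>C\<close>, so \<open>D\<close> meets \<open>C\<close> in \<open>v\<close> alone and the
  rest of \<open>D\<close> is among the at most two outer neighbours of \<open>v\<close>.\<close>

lemma clique_through_omega:
  assumes C: "C \<in> omega_cliques V E" "v \<in> C" and D: "D \<in> cliques V E" "v \<in> D" "\<not> D \<subseteq> C"
  shows "card D \<le> 3"
proof -
  obtain z where z: "z \<in> D" "z \<notin> C" using D(3) by blast
  have zV: "z \<in> V" using z(1) D(1) clique_sub by blast
  have "x = v" if x: "x \<in> D" "x \<in> C" for x
  proof -
    have "z \<noteq> x" "z \<noteq> v" using x z C by auto
    then show ?thesis
      using clique_edge[OF D(1) z(1) x(1)] clique_edge[OF D(1) z(1) D(2)] unique_nbr[OF C(1) zV z(2)] x(2) C(2)
      by blast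
  qed
  then have "D - {v} \<subseteq> nbhd V E v - C"
    using clique_edge[OF D(1,2)] by (auto simp: mem_nbhd)
  then have "card (D - {v}) \<le> card (nbhd V E v - C)"
    using finite_nbhd by (intro card_mono) auto
  then show ?thesis using card_outside[OF C] D(2) clique_finite[OF D(1)] by simp
qed

text \<open>A vertex of \<open>D\<close> in some \<open>\<omega>\<close>-clique would force
  \<open>card D \<le> 3\<close>, since \<open>D\<close> is not contained in that clique. Hence the
  different formula for \<open>ytilde_k\<close> from \<open>k = 4\<close> on.\<close>

lemma large_clique_outside:
  assumes D: "D \<in> cliques V E" "4 \<le> card D" and v: "v \<in> D" "v \<notin> K" and x: "x \<in> D"
  shows "x \<notin> K"
proof
  assume "x \<in> K"
  then have C: "cls x \<in> omega_cliques V E" "x \<in> cls x" using cls_mem by auto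
  have "\<not> D \<subseteq> cls x" using v C(1) unfolding K_def by blast
  then show False using clique_through_omega[OF C D(1) x] D(2) by simp
qed

text \<open>The other \<open>card D - 1\<close> vertices of the clique use up degree outside
  \<open>K\<close>. This is the source of the index \<open>\<Delta> + 1 - k\<close> in
  \<open>ytilde_k\<close>.\<close>

lemma card_nbhd_K_le:
  assumes D: "D \<in> cliques V E" "D \<inter> K = {}" "x \<in> D"
  shows "card (nbhd V E x \<inter> K) \<le> \<Delta> + 1 - card D"
proof -
  have "D - {x} \<subseteq> nbhd V E x"
  proof
    fix z assume "z \<in> D - {x}"
    then show "z \<in> nbhd V E x" using clique_edge[OF D(1,3), of z] by (auto simp: mem_nbhd)
  qed
  then have "(nbhd V E x \<inter> K) \<union> (D - {x}) \<subseteq> nbhd V E x" by blast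
  then have "card ((nbhd V E x \<inter> K) \<union> (D - {x})) \<le> \<Delta>"
    using card_mono[OF finite_nbhd] degree_le[of x] D clique_sub by (meson le_trans subsetD)
  moreover have "card ((nbhd V E x \<inter> K) \<union> (D - {x})) = card (nbhd V E x \<inter> K) + card (D - {x})"
    using finite_nbhd clique_finite[OF D(1)] D(2) by (intro card_Un_disjoint) auto
  moreover have "card (D - {x}) = card D - 1" "card D \<noteq> 0"
    using D(3) clique_finite[OF D(1)] by auto
  ultimately show ?thesis by linarith
qed

theorem frac_colouring_exists:
  assumes y: "0 \<le> y" "real_of_rat y \<le> ytilde \<Delta>"
  shows "\<exists>(w :: 'a \<Rightarrow> rat) f. (\<forall>v \<in> V. 0 \<le> w v) \<and> frac_colouring V E y w f \<and>
           real_of_rat (rho V E (\<lambda>v. 1 - w v)) \<le> real \<Delta> - (1 + mu \<Delta>) * real_of_rat y"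
proof -
  obtain f :: "'a set \<Rightarrow> rat" and pr :: "'a \<Rightarrow> rat" where
    f0: "\<And>S. S \<in> stable_sets V E \<Longrightarrow> 0 \<le> f S" and f1: "(\<Sum>S\<in>stable_sets V E. f S) = 1"
    and pr: "\<And>v. pr v = (\<Sum>S\<in>{S\<in>stable_sets V E. v \<in> S}. f S)"
    and nbhd_ge: "\<And>v. v \<in> V \<Longrightarrow> 1 \<le> (\<Sum>x\<in>closed_nbhd V E v. pr x)"
    and prK: "\<And>v. v \<in> K \<Longrightarrow> pr v = 1 / (of_nat \<Delta> - 1)"
    and prO: "\<And>v. v \<in> V - K \<Longrightarrow> p_bound \<Delta> (card (nbhd V E v \<inter> K)) \<le> real_of_rat (pr v)"
    by (rule good_distribution) (rule that; assumption)
  define Y where "Y = real_of_rat y"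
  define r where "r v = real_of_rat (pr v)" for v
  define u where "u = (\<lambda>v. 1 - y * pr v)"
  have u: "real_of_rat (u x) = 1 - Y * r x" for x
    by (simp add: u_def Y_def r_def of_rat_diff of_rat_mult)
  have Y0: "0 \<le> Y" using y(1) by (simp add: Y_def)
  have Yk: "Y \<le> ytilde_k k \<Delta>" if "1 \<le> k" "k \<le> \<Delta> - 2" for k
    using le_ytilde(1)[OF Delta y(2)] that by (simp add: Y_def)
  have Y1: "Y \<le> real \<Delta> - 1" using le_ytilde(2)[OF Delta y(2)] by (simp add: Y_def)
  have Y3: "Y * (1 - 3 * mu \<Delta>) \<le> real \<Delta> - 4" using le_ytilde(3)[OF Delta y(2)] by (simp add: Y_def)
  have \<Delta>1: "real (\<Delta> - 1) = real \<Delta> - 1" using Delta by simp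
  have rK: "r v = 1 / (real \<Delta> - 1)" if "v \<in> K" for v
    using prK[OF that] by (simp add: r_def of_rat_divide of_rat_diff)
  have mu_le: "mu \<Delta> \<le> r v" if v: "v \<in> V" for v
  proof (cases "v \<in> K")
    case True
    have "mu \<Delta> \<le> 1 / (real \<Delta> + 1)" unfolding mu_def by (rule mu_upto_le_inverse[OF Delta])
    also have "\<dots> \<le> 1 / (real \<Delta> - 1)" using Delta by (intro divide_left_mono) auto
    finally show ?thesis using rK[OF True] by simp
  next
    case False
    have "card (nbhd V E v \<inter> K) \<le> \<Delta>"
      using degree_le[OF v] card_mono[OF finite_nbhd, of "nbhd V E v \<inter> K" v] by simp
    then have "mu \<Delta> \<le> p_bound \<Delta> (card (nbhd V E v \<inter> K))" unfolding mu_def by (rule mu_upto_le)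
    also have "\<dots> \<le> r v" unfolding r_def using prO v False by blast
    finally show ?thesis .
  qed
  \<comment> \<open>Makes \<open>1 - mu \<Delta> * Y\<close> nonnegative, so that vertex counts may
    be replaced by their bounds 2 and 3.\<close>
  have muY: "mu \<Delta> * Y \<le> 1"
  proof -
    have "mu \<Delta> * Y \<le> 1 / (real \<Delta> + 1) * Y"
      unfolding mu_def using mu_upto_le_inverse[OF Delta] Y0 by (rule mult_right_mono)
    also have "\<dots> \<le> 1" using Y1 Delta by (simp add: field_simps)
    finally show ?thesis .
  qed
  have sum_le: "(\<Sum>x\<in>A. 1 - Y * r x) \<le> real (card A) * (1 - m * Y)"
    if "\<And>x. x \<in> A \<Longrightarrow> m \<le> r x" for A m
  proof -
    have "(\<Sum>x\<in>A. 1 - Y * r x) \<le> (\<Sum>x\<in>A. 1 - m * Y)"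
    proof (rule sum_mono)
      fix x assume "x \<in> A"
      then show "1 - Y * r x \<le> 1 - m * Y" using that Y0 mult_left_mono[of m "r x" Y] by (simp add: mult.commute)
    qed
    then show ?thesis by simp
  qed
  have wdeg: "real_of_rat (wdeg V E u v) = (\<Sum>x\<in>closed_nbhd V E v. 1 - Y * r x)" for v
    by (simp add: wdeg_def of_rat_sum u)
  have "real_of_rat (rho_at V E u v) \<le> real \<Delta> - (1 + mu \<Delta>) * Y" if v: "v \<in> V" for v
  proof -
    \<comment> \<open>In both cases \<open>a + b\<close> is exactly twice the target. On
      \<open>K\<close> the degree half has \<open>\<Delta> + 1 - Y - 2 * mu \<Delta> * Y\<close> and
      the clique half \<open>\<Delta> - 1 - Y\<close>; off \<open>K\<close> the saving of
      \<open>2 * mu \<Delta> * Y\<close> moves to the clique half.\<close>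
    have "\<exists>a b. real_of_rat (wdeg V E u v) \<le> a \<and> real_of_rat (wclique V E u v) \<le> b \<and>
        a + b \<le> 2 * (real \<Delta> - (1 + mu \<Delta>) * Y)"
    proof (cases "v \<in> K")
      case True
      define C where "C = cls v"
      have C: "C \<in> omega_cliques V E" "v \<in> C" using cls_mem[OF True] by (auto simp: C_def)
      have Ccl: "C \<in> cliques V E" "card C = \<Delta> - 1" using C(1) by (simp_all add: omega_clique)
      have finC: "finite C" using clique_finite[OF Ccl(1)] .
      have rC: "r x = 1 / (real \<Delta> - 1)" if "x \<in> C" for x
        using that C(1) by (intro rK) (auto simp: K_def)
      have sumC: "(\<Sum>x\<in>C. 1 - Y * r x) = real \<Delta> - 1 - Y"
      proof -
        have "(\<Sum>x\<in>C. 1 - Y * r x) = (\<Sum>x\<in>C. 1 - Y * (1 / (real \<Delta> - 1)))"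
          by (intro sum.cong refl) (simp add: rC)
        also have "\<dots> = (real \<Delta> - 1) * (1 - Y * (1 / (real \<Delta> - 1)))" by (simp only: sum_constant Ccl(2) \<Delta>1)
        also have "\<dots> = real \<Delta> - 1 - Y" using Delta by (simp add: field_simps)
        finally show ?thesis .
      qed
      have "closed_nbhd V E v = C \<union> (nbhd V E v - C)"
      proof -
        have "C \<subseteq> closed_nbhd V E v"
        proof
          fix x assume "x \<in> C"
          then show "x \<in> closed_nbhd V E v"
            using clique_edge[OF Ccl(1) C(2), of x] by (auto simp: closed_nbhd_def mem_nbhd)
        qed
        then show ?thesis using C(2) by (auto simp: closed_nbhd_def)
      qed
      then have "real_of_rat (wdeg V E u v) = (\<Sum>x\<in>C. 1 - Y * r x) + (\<Sum>x\<in>nbhd V E v - C. 1 - Y * r x)"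
        unfolding wdeg using finC finite_nbhd by (simp only: sum.union_disjoint finite_Diff Diff_disjoint)
      also have "\<dots> \<le> (real \<Delta> - 1 - Y) + real (card (nbhd V E v - C)) * (1 - mu \<Delta> * Y)"
        unfolding sumC by (intro add_left_mono sum_le mu_le) (auto simp: nbhd_def)
      also have "\<dots> \<le> (real \<Delta> - 1 - Y) + 2 * (1 - mu \<Delta> * Y)"
        using card_outside[OF C] muY by (intro add_left_mono mult_right_mono) auto
      finally have a: "real_of_rat (wdeg V E u v) \<le> (real \<Delta> - 1 - Y) + 2 * (1 - mu \<Delta> * Y)" .
      have b: "real_of_rat (wclique V E u v) \<le> real \<Delta> - 1 - Y"
      proof (rule of_rat_wclique_le[OF v], unfold u)
        fix D assume D: "D \<in> cliques V E" "v \<in> D"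
        show "(\<Sum>x\<in>D. 1 - Y * r x) \<le> real \<Delta> - 1 - Y"
        proof (cases "D \<subseteq> C")
          case True
          have "(\<Sum>x\<in>D. 1 - Y * r x) \<le> (\<Sum>x\<in>C. 1 - Y * r x)"
          proof (rule sum_mono2[OF finC True])
            fix x assume "x \<in> C - D"
            then have "r x = 1 / (real \<Delta> - 1)" using rC by blast
            \<comment> \<open>The term \<open>\<omega>\<close> in \<open>ytilde\<close>: no vertex
              of \<open>C\<close> gets negative remaining weight, so subcliques of \<open>C\<close>
              weigh at most as much as \<open>C\<close>.\<close>
            moreover have "Y / (real \<Delta> - 1) \<le> 1" using Y1 Delta by simp
            ultimately show "0 \<le> 1 - Y * r x" by simp
          qed
          then show ?thesis by (simp add: sumC)
        next
          case False
          have "(\<Sum>x\<in>D. 1 - Y * r x) \<le> real (card D) * (1 - mu \<Delta> * Y)"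
            using clique_sub[OF D(1)] by (intro sum_le mu_le) blast
          also have "\<dots> \<le> 3 * (1 - mu \<Delta> * Y)"
            using clique_through_omega[OF C D False] muY by (intro mult_right_mono) auto
          \<comment> \<open>The last term in \<open>ytilde\<close>, made for cliques of at most
            three vertices that leave \<open>C\<close>.\<close>
          also have "\<dots> \<le> real \<Delta> - 1 - Y" using Y3 by (simp add: algebra_simps)
          finally show ?thesis .
        qed
      qed
      show ?thesis by (intro exI conjI, rule a, rule b) (simp add: algebra_simps)
    next
      case False
      \<comment> \<open>At most \<open>\<Delta> + 1\<close> vertices, whose probabilities sum to at
        least 1.\<close>
      have a: "real_of_rat (wdeg V E u v) \<le> real \<Delta> + 1 - Y"
      proof -
        have "1 \<le> (\<Sum>x\<in>closed_nbhd V E v. r x)"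
          using nbhd_ge[OF v] unfolding r_def by (simp flip: of_rat_sum)
        then have "Y * 1 \<le> Y * (\<Sum>x\<in>closed_nbhd V E v. r x)" using Y0 by (rule mult_left_mono)
        moreover have "v \<notin> nbhd V E v" using no_loop by (simp add: mem_nbhd)
        then have "card (closed_nbhd V E v) = card (nbhd V E v) + 1"
          using finite_nbhd by (simp add: closed_nbhd_def)
        then have "real (card (closed_nbhd V E v)) \<le> real \<Delta> + 1" using degree_le[OF v] by simp
        ultimately show ?thesis by (simp add: wdeg sum_subtractf flip: sum_distrib_left)
      qed
      have b: "real_of_rat (wclique V E u v) \<le> real \<Delta> - 1 - Y - 2 * (mu \<Delta> * Y)"
      proof (rule of_rat_wclique_le[OF v], unfold u)
        fix D assume D: "D \<in> cliques V E" "v \<in> D"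
        define k where "k = card D"
        \<comment> \<open>A lower bound for the probabilities on \<open>D\<close>. For
          \<open>k \<ge> 4\<close> the clique avoids \<open>K\<close>, and its vertices have few
          neighbours there, so a minimum over fewer values of \<open>d\<close> applies.\<close>
        define m where "m = (if k \<le> 3 then mu \<Delta> else mu_upto (\<Delta> + 1 - k) \<Delta>)"
        have "D \<notin> omega_cliques V E" using False D(2) unfolding K_def by blast
        then have k2: "k \<le> \<Delta> - 2"
          using card_clique_le[OF D(1)] D(1) by (simp add: omega_clique k_def)
        have k1: "1 \<le> k" using D(2) clique_finite[OF D(1)]
          by (simp add: k_def Suc_le_eq card_gt_0_iff) blast
        have m: "m \<le> r x" if x: "x \<in> D" for x
        proof (cases "k \<le> 3")
          case True
          then show ?thesis using mu_le x clique_sub[OF D(1)] by (auto simp: m_def)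
        next
          case k3: False
          have DK: "D \<inter> K = {}"
            using large_clique_outside[OF D(1) _ D(2) False] k3 by (auto simp: k_def)
          have "m \<le> p_bound \<Delta> (card (nbhd V E x \<inter> K))"
            using k3 card_nbhd_K_le[OF D(1) DK x] by (simp add: m_def k_def mu_upto_le)
          also have "\<dots> \<le> r x"
            unfolding r_def using x DK clique_sub[OF D(1)] by (intro prO) blast
          finally show ?thesis .
        qed
        have "(\<Sum>x\<in>D. 1 - Y * r x) \<le> real k * (1 - m * Y)"
          unfolding k_def using m by (rule sum_le)
        also have "\<dots> = real k - real k * m * Y" by (simp add: right_diff_distrib)
        finally have "(\<Sum>x\<in>D. 1 - Y * r x) \<le> real k - real k * m * Y" .
        moreover have "(1 + mu \<Delta>) * Y \<le> 1 / 2 * (real \<Delta> - 1 - real k) + (1 / 2 + 1 / 2 * real k * m) * Y"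
          unfolding m_def by (rule le_ytilde_k[OF Delta k2 Yk[OF k1 k2]])
        then have "Y + mu \<Delta> * Y \<le> 1 / 2 * (real \<Delta> - 1 - real k) + (1 / 2 * Y + 1 / 2 * (real k * m * Y))"
          by (simp only: distrib_right mult_1_left mult.assoc)
        ultimately show "(\<Sum>x\<in>D. 1 - Y * r x) \<le> real \<Delta> - 1 - Y - 2 * (mu \<Delta> * Y)"
          by (rule clique_arith)
      qed
      show ?thesis by (intro exI conjI, rule a, rule b) (simp add: algebra_simps)
    qed
    then show ?thesis by (auto simp: rho_at_def of_rat_divide of_rat_add)
  qed
  then have rho_le: "real_of_rat (rho V E u) \<le> real \<Delta> - (1 + mu \<Delta>) * Y"
    unfolding rho_def using finite_V V_nonempty by (intro of_rat_Max_le) auto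
  have col: "frac_colouring V E y (\<lambda>v. y * pr v) (\<lambda>S. y * f S)"
    unfolding frac_colouring_def using f0 f1 y(1) by (simp add: pr flip: sum_distrib_left)
  have "0 \<le> y * pr v" for v
    unfolding pr using f0 y(1) by (intro mult_nonneg_nonneg sum_nonneg) auto
  then show ?thesis
    using col rho_le unfolding u_def Y_def
    by (intro exI[of _ "\<lambda>v. y * pr v"] exI[of _ "\<lambda>S. y * f S"] conjI ballI)
qed

end

theorem theorem6:
  fixes V :: "'a set" and E :: "'a set set" and \<Delta> :: nat and y :: rat
  assumes "fin_graph V E"
    and "max_degree V E = \<Delta>" and "\<Delta> \<ge> 6"
    and "clique_number V E = \<Delta> - 1"
    and "pairwise disjnt (omega_cliques V E)"
    and "\<forall>C \<in> omega_cliques V E. \<forall>v \<in> V - C. card (nbhd V E v \<inter> C) \<le> 1"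
    and "0 \<le> y" and "real_of_rat y \<le> ytilde \<Delta>"
  shows "\<exists>(w :: 'a \<Rightarrow> rat) f. (\<forall>v \<in> V. 0 \<le> w v) \<and> frac_colouring V E y w f \<and>
           real_of_rat (rho V E (\<lambda>v. 1 - w v)) \<le> real \<Delta> - (1 + mu \<Delta>) * real_of_rat y"
proof -
  interpret sparse_clique_graph V E \<Delta>
    by standard (use assms(1-6) in simp_all)
  show ?thesis using assms(7,8) by (rule frac_colouring_exists)
qed

end
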